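(* Let $\alpha\in(0,2)$. There exist a real number $y_\alpha>0$ and a nondecreasing function $\Phi_\alpha:\mathbb{R}\to\mathbb{R}$ which is of regularity $C^{1+\alpha/2}$ at each point of $\mathbb{R}$ and analytic on $(-y_\alpha,y_\alpha)$, such that $$\Phi_\alpha=0 \ \text{ on } (-\infty,-y_\alpha),\qquad \Phi_\alpha=1 \ \text{ on } (y_\alpha,+\infty),$$ and $$(\Lambda^\alpha\Phi_\alpha)(y)=\frac{y}{\alpha+1}\qquad\text{for all } y\in(-y_\alpha,y_\alpha).$$
   Context: For $\alpha\in(0,2)$, $\Lambda^\alpha$ is the operator defined via the Fourier transform by $\widehat{(\Lambda^\alpha w)}(\xi)=|\xi|^\alpha\widehat w(\xi)$ for $w$ in the Schwartz space. It has the Lévy–Khintchine representation $$-\Lambda^\alpha w(x)=C(\alpha)\int_{\mathbb{R}}\left\{w(x+z)-w(x)-z\,w'(x)\mathbf 1_{\{|z|\le 1\}}\right\}\frac{dz}{|z|^{1+\alpha}},$$ with a constant $C(\alpha)>0$ (the one for which this agrees with the Fourier definition), and this formula is used to define $\Lambda^\alpha w$ for functions $w$ that are bounded and sufficiently smooth but not necessarily decaying at infinity. Regularity $C^{1+\alpha/2}$ means continuously differentiable with derivative Hölder continuous of exponent $\alpha/2\in(0,1)$. *)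

theory Defs
  imports "HOL-Analysis.Analysis"
begin

definition schwartz :: "(real \<Rightarrow> real) \<Rightarrow> bool" where
  "schwartz w \<longleftrightarrow>
     (\<forall>k x. (deriv ^^ k) w differentiable (at x)) \<and>
     (\<forall>m k. bounded (range (\<lambda>x. x ^ m * (deriv ^^ k) w x)))"

text \<open>The frequency is angular, so that the second derivative has symbol minus the square
  of \<open>\<xi>\<close>, as is needed for the fractional Laplacian to have symbol \<open>\<bar>\<xi>\<bar> powr \<alpha>\<close> with the
  usual constant.\<close>

definition fourier :: "(real \<Rightarrow> real) \<Rightarrow> real \<Rightarrow> complex" where
  "fourier w \<xi> = (LINT x|lborel. cis (- (\<xi> * x)) * complex_of_real (w x))"

definition levy_integral :: "real \<Rightarrow> (real \<Rightarrow> real) \<Rightarrow> real \<Rightarrow> real" where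
  "levy_integral \<alpha> w x =
     (LINT z|lborel.
        (w (x + z) - w x - z * deriv w x * indicat_real {z. \<bar>z\<bar> \<le> 1} z) / \<bar>z\<bar> powr (1 + \<alpha>))"

text \<open>The constant \<open>C(\<alpha>)\<close> is the one for which the singular integral has Fourier symbol
  \<open>\<bar>\<xi>\<bar> powr \<alpha>\<close> on Schwartz functions. Real-valued functions suffice to determine it, and the
  identity extends to complex-valued ones by linearity.\<close>

definition levy_const :: "real \<Rightarrow> real" where
  "levy_const \<alpha> = (THE C. C > 0 \<and>
     (\<forall>w. schwartz w \<longrightarrow>
       (\<forall>\<xi>. fourier (\<lambda>x. - (C * levy_integral \<alpha> w x)) \<xi>
             = complex_of_real (\<bar>\<xi>\<bar> powr \<alpha>) * fourier w \<xi>)))"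

definition frac_laplacian :: "real \<Rightarrow> (real \<Rightarrow> real) \<Rightarrow> real \<Rightarrow> real" where
  "frac_laplacian \<alpha> w x = - (levy_const \<alpha> * levy_integral \<alpha> w x)"

definition C1_holder_at :: "real \<Rightarrow> (real \<Rightarrow> real) \<Rightarrow> real \<Rightarrow> bool" where
  "C1_holder_at \<gamma> f x \<longleftrightarrow>
     (\<exists>U. open U \<and> x \<in> U \<and>
        (\<forall>u\<in>U. f differentiable (at u)) \<and>
        continuous_on U (deriv f) \<and>
        (\<exists>L. \<forall>u\<in>U. \<forall>v\<in>U. \<bar>deriv f u - deriv f v\<bar> \<le> L * \<bar>u - v\<bar> powr \<gamma>))"

text \<open>Real analyticity; the library's \<open>analytic_on\<close> is only for complex functions.\<close>

definition real_analytic_on :: "(real \<Rightarrow> real) \<Rightarrow> real set \<Rightarrow> bool" where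
  "real_analytic_on f S \<longleftrightarrow> (\<forall>x\<in>S. \<exists>F. (\<lambda>h. f (x + h)) has_fps_expansion F)"

end

theory Submission
  imports Defs "HOL-Probability.Characteristic_Functions" "HOL-Probability.Sinc_Integral"
begin

text \<open>
  The function is explicit: its derivative is a multiple of \<open>(1 - (y/R)^2)\<close>, cut off at zero and
  raised to the power \<open>\<gamma> = \<alpha>/2\<close>. Getoor observed that the fractional Laplacian of order \<open>\<alpha>\<close> of this
  function is constant on the interval where it is positive, so the fractional Laplacian of a
  primitive is affine there, and even linear because the primitive is odd up to a constant.

  The linearity is proved directly for the primitive \<open>P\<close> of \<open>u(t) = max 0 (1 - t^2) powr \<gamma>\<close>.
  The compensating term of the Levy integral is odd in \<open>z\<close>, so that the integral is one half of the
  integral of the second difference \<open>P(x+z) + P(x-z) - 2 P(x)\<close> against \<open>1/\<bar>z\<bar>^(1+\<alpha>)\<close>, and an integration by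
  parts leaves \<open>1/\<alpha>\<close> times the principal value of the integral of \<open>u(x+z) sgn(z) \<bar>z\<bar>^(-\<alpha>)\<close>.
  The automorphism \<open>t = (x+s)/(1+xs)\<close> of the interval \<open>(-1,1)\<close> moves the singularity from \<open>t = x\<close> to \<open>s = 0\<close>
  and transforms \<open>u\<close> by a power of the conformal factor. Since \<open>\<gamma> = \<alpha>/2\<close>, most powers of \<open>1 + xs\<close> cancel, and
  the principal value becomes \<open>(1-x^2)^(1-\<gamma>)\<close> times the integral over \<open>0 < s < 1\<close> of
  \<open>s^(-\<alpha>) u(s) ((1+xs)^(-2) - (1-xs)^(-2)) = - 4 x s^(1-\<alpha>) u(s) / (1 - x^2 s^2)^2\<close>.
  The substitution \<open>s = r / sqrt(1 - x^2 + x^2 r^2)\<close> turns this last integral into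
  \<open>(1-x^2)^(\<gamma>-1)\<close> times an integral that is free of \<open>x\<close>; the two powers of \<open>1-x^2\<close> cancel, and a
  constant multiple of \<open>x\<close> remains. These steps are \<open>truncated_convolution_moebius\<close>,
  \<open>disc_rescale_integral\<close> and \<open>truncated_odd_convolution\<close>. All of them are carried out on integrals truncated
  near the singularity. The automorphism does not respect the symmetric truncation of the principal
  value, but the mismatch of the cutoffs is of second order and contributes only \<open>O(s^(2-\<alpha>))\<close>.

  The constant \<open>C(\<alpha>)\<close> enters through its positivity only. For a Schwartz function Fubini's theorem
  shows that the Levy integral multiplies the Fourier transform by minus the integral of
  \<open>(1 - cos(\<xi>z)) / \<bar>z\<bar>^(1+\<alpha>)\<close>, which is \<open>\<bar>\<xi>\<bar>^\<alpha>\<close> times a positive number; the inverse of this number is a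
  constant with the required property, and testing with a Gaussian shows that there is no other.

  Finally, for \<open>\<Phi>(y) = P(y/R)/M\<close> with \<open>M\<close> the mass of \<open>u\<close>, the fractional Laplacian is
  \<open>y\<close> times a positive multiple of \<open>R^(-1-\<alpha>)\<close>, so that exactly one radius \<open>R\<close> gives the slope
  \<open>1/(\<alpha>+1)\<close>. The regularity of \<open>\<Phi>\<close> at the end points is the Hoelder continuity of the power \<open>\<gamma>\<close>, and
  the analyticity in between comes from the binomial series.
\<close>

section \<open>The Levy integral and second differences\<close>

text \<open>The square makes the singularity at zero integrable because \<open>\<alpha> < 2\<close>, the bound one makes the tail
  integrable because \<open>\<alpha> > 0\<close>; every integrand with the Levy kernel is compared with this one.\<close>

lemma levy_majorant_integrable:
  fixes \<alpha> :: real
  assumes "0 < \<alpha>" and "\<alpha> < 2"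
  shows "integrable lborel (\<lambda>z. min 1 (z\<^sup>2) / \<bar>z\<bar> powr (1 + \<alpha>))"
proof -
  let ?h = "\<lambda>z::real. min 1 (z\<^sup>2) / \<bar>z\<bar> powr (1 + \<alpha>)"
  have meas: "?h \<in> borel_measurable borel" by measurable
  have a: "(\<lambda>z::real. z powr (1 - \<alpha>)) integrable_on {0..1}"
    by (rule integrable_on_powr_from_0) (use assms in auto)
  have b: "(\<lambda>z::real. z powr (-1 - \<alpha>)) integrable_on {1..}"
    using has_integral_powr_to_inf[of "-1-\<alpha>" 1] assms by (auto simp: integrable_on_def)
  have a': "?h integrable_on {0..1}"
  proof (rule integrable_eq[OF a])
    fix z :: real assume z: "z \<in> {0..1}"
    show "z powr (1 - \<alpha>) = ?h z"
    proof (cases "z = 0")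
      case False
      with z have "z\<^sup>2 \<le> 1" by (auto simp: power_le_one)
      moreover have "z powr (1 - \<alpha>) = z powr 2 / z powr (1 + \<alpha>)"
        by (simp flip: powr_diff)
      ultimately show ?thesis using z False by (simp add: min_def)
    qed auto
  qed
  have b': "?h integrable_on {1..}"
  proof (rule integrable_eq[OF b])
    fix z :: real assume z: "z \<in> {1..}"
    then have "1 \<le> z\<^sup>2" by (auto simp: one_le_power)
    moreover have "z powr (-1 - \<alpha>) = 1 / z powr (1 + \<alpha>)"
      by (simp add: powr_minus_divide[symmetric] algebra_simps)
    ultimately show "z powr (-1 - \<alpha>) = ?h z" using z by (simp add: min_def)
  qed
  have lift: "set_integrable lborel A ?h" if "?h integrable_on A" "A \<in> sets borel" for A
  proof -
    have "?h absolutely_integrable_on A"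
      by (rule nonnegative_absolutely_integrable_1) (use that in auto)
    then show ?thesis
      unfolding set_integrable_def
      by (subst (asm) integrable_completion) (use that meas in auto)
  qed
  have "set_integrable lborel ({0..1} \<union> {1..}) ?h"
    by (rule set_integrable_Un) (use lift[OF a'] lift[OF b'] in auto)
  also have "{0..1} \<union> {1..} = {0::real..}" by auto
  finally have pos: "integrable lborel (\<lambda>z. indicator {0..} z * ?h z)"
    by (simp add: set_integrable_def)
  then have neg: "integrable lborel (\<lambda>z. indicator {0..} (0 + (-1) * z) * ?h (0 + (-1) * z))"
    by (rule lborel_integrable_real_affine) auto
  show ?thesis
    by (rule Bochner_Integration.integrable_bound[OF Bochner_Integration.integrable_add[OF pos neg]])
       (auto simp: indicator_def)
qed

definition second_difference :: "(real \<Rightarrow> real) \<Rightarrow> real \<Rightarrow> real \<Rightarrow> real" where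
  "second_difference w x z = w (x + z) + w (x - z) - 2 * w x"

text \<open>Increments of both signs occur below, and only the distance of the intermediate point to \<open>x\<close>
  matters there.\<close>

lemma mean_value_increment:
  fixes f f' :: "real \<Rightarrow> real"
  assumes diff: "\<And>y. \<bar>y - x\<bar> \<le> \<bar>z\<bar> \<Longrightarrow> (f has_real_derivative f' y) (at y)"
  shows "\<exists>y. \<bar>y - x\<bar> \<le> \<bar>z\<bar> \<and> f (x + z) - f x = z * f' y"
proof (cases z "0::real" rule: linorder_cases)
  case less
  have "\<exists>y>x+z. y < x \<and> f x - f (x + z) = (x - (x + z)) * f' y"
    by (rule MVT2) (use less in \<open>auto intro!: diff\<close>)
  then obtain y where "y > x + z" "y < x" "f x - f (x + z) = (x - (x + z)) * f' y" by blast
  then show ?thesis by (intro exI[of _ y]) (auto simp: algebra_simps)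
next
  case greater
  have "\<exists>y>x. y < x + z \<and> f (x + z) - f x = ((x + z) - x) * f' y"
    by (rule MVT2) (use greater in \<open>auto intro!: diff\<close>)
  then obtain y where "y > x" "y < x + z" "f (x + z) - f x = ((x + z) - x) * f' y" by blast
  then show ?thesis by (intro exI[of _ y]) (auto simp: algebra_simps)
qed auto

text \<open>Near zero the numerator is \<open>z\<close> times an increment of the derivative, hence quadratic; away from
  zero it is bounded. The Lipschitz bound on the derivative is local, so that the lemma also
  covers functions that lose regularity away from \<open>x\<close>.\<close>

lemma levy_integrand_integrable:
  fixes w :: "real \<Rightarrow> real"
  assumes \<alpha>: "0 < \<alpha>" "\<alpha> < 2"
    and meas [measurable]: "w \<in> borel_measurable borel"
    and bdd: "\<And>y. \<bar>w y\<bar> \<le> B"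
    and \<delta>: "0 < \<delta>" "\<delta> \<le> 1"
    and diff: "\<And>y. \<bar>y - x\<bar> \<le> \<delta> \<Longrightarrow> (w has_real_derivative w' y) (at y)"
    and lip: "\<And>y. \<bar>y - x\<bar> \<le> \<delta> \<Longrightarrow> \<bar>w' y - w' x\<bar> \<le> L * \<bar>y - x\<bar>"
  shows "integrable lborel (\<lambda>z. (w (x + z) - w x - z * w' x * indicat_real {z. \<bar>z\<bar> \<le> 1} z)
                                  / \<bar>z\<bar> powr (1 + \<alpha>))"
proof -
  let ?n = "\<lambda>z. w (x + z) - w x - z * w' x * indicat_real {z. \<bar>z\<bar> \<le> 1} z"
  \<comment> \<open>The second summand covers \<open>\<delta> < \<bar>z\<bar>\<close>, where boundedness is compared with \<open>min 1 (z^2) \<ge> \<delta>^2\<close>.\<close>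
  define K where "K = \<bar>L\<bar> + (2 * B + \<bar>w' x\<bar>) / \<delta>\<^sup>2"
  have B0: "0 \<le> B" using bdd[of 0] by linarith
  have near: "\<bar>w (x + z) - w x - z * w' x\<bar> \<le> \<bar>L\<bar> * z\<^sup>2" if z: "\<bar>z\<bar> \<le> \<delta>" for z
  proof -
    have "\<exists>y. \<bar>y - x\<bar> \<le> \<bar>z\<bar> \<and> w (x + z) - w x = z * w' y"
      by (rule mean_value_increment) (use z diff in auto)
    then obtain y where y: "\<bar>y - x\<bar> \<le> \<bar>z\<bar>" "w (x + z) - w x = z * w' y" by blast
    have "\<bar>w' y - w' x\<bar> \<le> L * \<bar>y - x\<bar>" using y z by (intro lip) auto
    also have "\<dots> \<le> \<bar>L\<bar> * \<bar>z\<bar>" using y(1) by (intro mult_mono) auto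
    finally have "\<bar>z\<bar> * \<bar>w' y - w' x\<bar> \<le> \<bar>z\<bar> * (\<bar>L\<bar> * \<bar>z\<bar>)" by (intro mult_left_mono) auto
    moreover have "w (x + z) - w x - z * w' x = z * (w' y - w' x)" using y(2) by (simp add: algebra_simps)
    ultimately show ?thesis
      by (simp add: abs_mult power2_eq_square mult_ac abs_mult_self_eq)
  qed
  have bound: "\<bar>?n z\<bar> \<le> K * min 1 (z\<^sup>2)" for z
  proof -
    have n: "\<bar>?n z\<bar> \<le> 2 * B + \<bar>z\<bar> * \<bar>w' x\<bar> * indicat_real {z. \<bar>z\<bar> \<le> 1} z"
      using bdd[of "x + z"] bdd[of x] by (auto simp: indicator_def abs_mult[symmetric])
    have d2: "0 < \<delta>\<^sup>2" "\<delta>\<^sup>2 \<le> 1" using \<delta> by (auto simp: power_le_one)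
    have e: "2 * B + \<bar>w' x\<bar> \<le> (2 * B + \<bar>w' x\<bar>) / \<delta>\<^sup>2"
      using d2 B0 by (simp add: le_divide_eq mult_left_le)
    show ?thesis
    proof (cases "\<bar>z\<bar> \<le> 1")
      case False
      then have "1 \<le> z\<^sup>2" by (metis abs_le_square_iff abs_one linorder_linear one_power2)
      then have "min 1 (z\<^sup>2) = 1" by simp
      then show ?thesis using n e False B0 by (simp add: K_def)
    next
      case True
      then have z1: "z\<^sup>2 \<le> 1" by (simp add: abs_square_le_1)
      show ?thesis
      proof (cases "\<bar>z\<bar> \<le> \<delta>")
        case T: True
        have "\<bar>L\<bar> * z\<^sup>2 \<le> K * z\<^sup>2" unfolding K_def using B0 by (intro mult_right_mono) auto
        then show ?thesis using near[OF T] True z1 by (simp add: min_def)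
      next
        case F: False
        then have "\<delta>\<^sup>2 \<le> z\<^sup>2" using \<delta> by (metis abs_le_square_iff abs_of_pos linorder_linear)
        then have "1 \<le> z\<^sup>2 / \<delta>\<^sup>2" using d2 by simp
        then have "(2 * B + \<bar>w' x\<bar>) * 1 \<le> (2 * B + \<bar>w' x\<bar>) * (z\<^sup>2 / \<delta>\<^sup>2)"
          using B0 by (intro mult_left_mono) auto
        also have "\<dots> \<le> K * z\<^sup>2" by (simp add: K_def distrib_right)
        finally have "2 * B + \<bar>w' x\<bar> \<le> K * z\<^sup>2" by simp
        moreover have "\<bar>z\<bar> * \<bar>w' x\<bar> \<le> 1 * \<bar>w' x\<bar>" using True by (intro mult_right_mono) auto
        ultimately show ?thesis using n True z1 by (simp add: min_def)
      qed
    qed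
  qed
  show ?thesis
  proof (rule Bochner_Integration.integrable_bound)
    show "integrable lborel (\<lambda>z. K * (min 1 (z\<^sup>2) / \<bar>z\<bar> powr (1 + \<alpha>)))"
      using levy_majorant_integrable[OF \<alpha>] by (rule integrable_mult_right)
    show "AE z in lborel. norm (?n z / \<bar>z\<bar> powr (1 + \<alpha>))
            \<le> norm (K * (min 1 (z\<^sup>2) / \<bar>z\<bar> powr (1 + \<alpha>)))"
    proof (rule AE_I2)
      fix z :: real
      have "\<bar>?n z\<bar> / \<bar>z\<bar> powr (1 + \<alpha>) \<le> K * min 1 (z\<^sup>2) / \<bar>z\<bar> powr (1 + \<alpha>)"
        using bound by (intro divide_right_mono) auto
      also have "\<dots> \<le> \<bar>K * min 1 (z\<^sup>2) / \<bar>z\<bar> powr (1 + \<alpha>)\<bar>" by (rule abs_ge_self)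
      finally show "norm (?n z / \<bar>z\<bar> powr (1 + \<alpha>)) \<le> norm (K * (min 1 (z\<^sup>2) / \<bar>z\<bar> powr (1 + \<alpha>)))"
        by (simp add: abs_divide)
    qed
  qed measurable
qed

text \<open>Reflection \<open>z \<mapsto> -z\<close> preserves the kernel and changes the sign of the compensating term.\<close>

lemma levy_integral_second_difference:
  assumes int: "integrable lborel (\<lambda>z. (w (x + z) - w x - z * deriv w x * indicat_real {z. \<bar>z\<bar> \<le> 1} z)
                                  / \<bar>z\<bar> powr (1 + \<alpha>))"
  shows "integrable lborel (\<lambda>z. second_difference w x z / \<bar>z\<bar> powr (1 + \<alpha>))" (is ?I)
    and "levy_integral \<alpha> w x = (LINT z|lborel. second_difference w x z / \<bar>z\<bar> powr (1 + \<alpha>)) / 2" (is ?E)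
proof -
  let ?f = "\<lambda>z. (w (x + z) - w x - z * deriv w x * indicat_real {z. \<bar>z\<bar> \<le> 1} z) / \<bar>z\<bar> powr (1 + \<alpha>)"
  have int': "integrable lborel (\<lambda>z. ?f (0 + (-1) * z))"
    by (rule lborel_integrable_real_affine[OF int]) auto
  have eq: "?f z + ?f (0 + (-1) * z) = second_difference w x z / \<bar>z\<bar> powr (1 + \<alpha>)" for z
    by (simp add: second_difference_def indicator_def add_divide_distrib[symmetric])
  show ?I using Bochner_Integration.integrable_add[OF int int'] by (simp only: eq)
  have "levy_integral \<alpha> w x = (LINT z|lborel. ?f (0 + (-1) * z))"
    unfolding levy_integral_def by (subst lborel_integral_real_affine[where c = "-1" and t = 0]) auto
  moreover have "(LINT z|lborel. ?f z) + (LINT z|lborel. ?f (0 + (-1) * z))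
      = (LINT z|lborel. second_difference w x z / \<bar>z\<bar> powr (1 + \<alpha>))"
    using Bochner_Integration.integral_add[OF int int'] by (simp only: eq)
  ultimately show ?E by (simp add: levy_integral_def)
qed

section \<open>The constant of the Levy-Khintchine representation\<close>

lemma schwartz_has_derivatives:
  assumes "schwartz w"
  shows "(w has_real_derivative deriv w x) (at x)"
    and "(deriv w has_real_derivative deriv (deriv w) x) (at x)"
proof -
  have d: "(deriv ^^ k) w differentiable (at x)" for k using assms by (auto simp: schwartz_def)
  show "(w has_real_derivative deriv w x) (at x)" using d[of 0]
    by (simp add: DERIV_deriv_iff_real_differentiable)
  show "(deriv w has_real_derivative deriv (deriv w) x) (at x)" using d[of 1]
    by (simp add: DERIV_deriv_iff_real_differentiable)
qed

lemma schwartz_quadratic_decay: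
  assumes "schwartz w"
  shows "\<exists>K. \<forall>x. \<bar>(deriv ^^ k) w x\<bar> \<le> K / (1 + x\<^sup>2)"
proof -
  have "bounded (range (\<lambda>x. x ^ m * (deriv ^^ k) w x))" for m using assms by (auto simp: schwartz_def)
  from this[of 0] this[of 2] obtain A B where
    A: "\<And>x. \<bar>(deriv ^^ k) w x\<bar> \<le> A" and B: "\<And>x. \<bar>x\<^sup>2 * (deriv ^^ k) w x\<bar> \<le> B"
    by (auto simp: bounded_iff)
  have "\<bar>(deriv ^^ k) w x\<bar> \<le> (A + B) / (1 + x\<^sup>2)" for x
  proof -
    have p: "0 < 1 + x\<^sup>2" by (simp add: add_pos_nonneg)
    have "\<bar>(deriv ^^ k) w x\<bar> * (1 + x\<^sup>2) = \<bar>(deriv ^^ k) w x\<bar> + \<bar>x\<^sup>2 * (deriv ^^ k) w x\<bar>"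
      by (simp add: abs_mult algebra_simps)
    also have "\<dots> \<le> A + B" using A[of x] B[of x] by linarith
    finally show ?thesis using p by (simp add: le_divide_eq)
  qed
  then show ?thesis by blast
qed

lemma integrable_inverse_one_plus_square: "integrable lborel (\<lambda>x::real. 1 / (1 + x\<^sup>2))"
  using integrable_inverse_1_plus_square by (simp add: set_integrable_def inverse_eq_divide)

lemma schwartz_integrable:
  assumes "schwartz w"
  shows "integrable lborel w"
proof -
  have m: "w \<in> borel_measurable borel"
    by (intro borel_measurable_continuous_onI)
       (meson DERIV_isCont assms continuous_at_imp_continuous_on schwartz_has_derivatives(1))
  obtain K where K: "\<And>x. \<bar>w x\<bar> \<le> K / (1 + x\<^sup>2)"
    using schwartz_quadratic_decay[OF assms, of 0] by auto
  have "integrable lborel (\<lambda>x. K * (1 / (1 + x\<^sup>2)))"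
    using integrable_inverse_one_plus_square by (rule integrable_mult_right)
  then show ?thesis
    by (rule Bochner_Integration.integrable_bound)
       (use m K K[of 0] in \<open>auto simp: abs_divide add_pos_nonneg\<close>)
qed

lemma schwartz_measurable:
  assumes "schwartz w"
  shows "w \<in> borel_measurable borel"
  using borel_measurable_integrable[OF schwartz_integrable[OF assms]] by simp

lemma schwartz_levy_integrand_integrable:
  assumes "0 < \<alpha>" "\<alpha> < 2" and w: "schwartz w"
  shows "integrable lborel (\<lambda>z. (w (x + z) - w x - z * deriv w x * indicat_real {z. \<bar>z\<bar> \<le> 1} z)
                                  / \<bar>z\<bar> powr (1 + \<alpha>))"
proof -
  obtain B where B: "\<And>x. \<bar>w x\<bar> \<le> B"
  proof -
    have "bounded (range (\<lambda>x. x ^ 0 * (deriv ^^ 0) w x))" using w unfolding schwartz_def by blast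
    then show ?thesis using that by (auto simp: bounded_iff)
  qed
  obtain K where K: "\<And>x. \<bar>deriv (deriv w) x\<bar> \<le> K / (1 + x\<^sup>2)"
    using schwartz_quadratic_decay[OF w, of 2] by (auto simp: numeral_2_eq_2)
  have K0: "0 \<le> K" using K[of 0] by simp
  show ?thesis
  proof (rule levy_integrand_integrable[where B = B and \<delta> = 1 and L = K])
    fix y
    have "\<exists>t. \<bar>t - x\<bar> \<le> \<bar>y - x\<bar> \<and> deriv w (x + (y - x)) - deriv w x = (y - x) * deriv (deriv w) t"
      by (rule mean_value_increment) (rule schwartz_has_derivatives(2)[OF w])
    then obtain t where t: "deriv w y - deriv w x = (y - x) * deriv (deriv w) t" by auto
    have "K / (1 + t\<^sup>2) \<le> K / 1" using K0 by (intro divide_left_mono) (auto simp: add_pos_nonneg)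
    with K[of t] have "\<bar>deriv (deriv w) t\<bar> \<le> K" by simp
    then show "\<bar>deriv w y - deriv w x\<bar> \<le> K * \<bar>y - x\<bar>"
      unfolding t abs_mult by (subst mult.commute, intro mult_right_mono) auto
  qed (use assms B schwartz_measurable[OF w] schwartz_has_derivatives(1)[OF w] in auto)
qed

text \<open>The weight \<open>1/(1+x^2)\<close> survives the application of the mean value theorem, up to a constant,
  because for \<open>\<bar>z\<bar> \<le> 1\<close> the intermediate point has distance at most 3 to \<open>x\<close>. It provides the
  integrability in \<open>x\<close>, uniformly in \<open>z\<close>, that Fubini's theorem requires.\<close>

lemma schwartz_second_difference_bound:
  assumes w: "schwartz w"
  shows "\<exists>K. \<forall>x z. \<bar>z\<bar> \<le> 1 \<longrightarrow> \<bar>second_difference w x z\<bar> \<le> K * z\<^sup>2 / (1 + x\<^sup>2)"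
proof -
  obtain K where K: "\<And>x. \<bar>deriv (deriv w) x\<bar> \<le> K / (1 + x\<^sup>2)"
    using schwartz_quadratic_decay[OF w, of 2] by (auto simp: numeral_2_eq_2)
  have K0: "0 \<le> K" using K[of 0] by simp
  have "\<bar>second_difference w x z\<bar> \<le> 38 * K * z\<^sup>2 / (1 + x\<^sup>2)" if z: "\<bar>z\<bar> \<le> 1" for x z
  proof -
    note d = schwartz_has_derivatives[OF w]
    have "\<exists>y. \<bar>y - x\<bar> \<le> \<bar>z\<bar> \<and> w (x + z) - w x = z * deriv w y"
      by (rule mean_value_increment) (rule d)
    then obtain y1 where y1: "\<bar>y1 - x\<bar> \<le> \<bar>z\<bar>" "w (x + z) - w x = z * deriv w y1" by blast
    have "\<exists>y. \<bar>y - x\<bar> \<le> \<bar>-z\<bar> \<and> w (x + (-z)) - w x = (-z) * deriv w y"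
      by (rule mean_value_increment) (rule d)
    then obtain y2 where y2: "\<bar>y2 - x\<bar> \<le> \<bar>z\<bar>" "w (x - z) - w x = - z * deriv w y2" by auto
    have "\<exists>y. \<bar>y - y2\<bar> \<le> \<bar>y1 - y2\<bar> \<and> deriv w (y2 + (y1 - y2)) - deriv w y2 = (y1 - y2) * deriv (deriv w) y"
      by (rule mean_value_increment) (rule d)
    then obtain y3 where y3: "\<bar>y3 - y2\<bar> \<le> \<bar>y1 - y2\<bar>" "deriv w y1 - deriv w y2 = (y1 - y2) * deriv (deriv w) y3" by auto
    have "second_difference w x z = z * (deriv w y1 - deriv w y2)"
      using y1 y2 by (simp add: second_difference_def algebra_simps)
    then have "\<bar>second_difference w x z\<bar> = \<bar>z\<bar> * (\<bar>y1 - y2\<bar> * \<bar>deriv (deriv w) y3\<bar>)"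
      by (simp add: y3 abs_mult)
    also have "\<dots> \<le> \<bar>z\<bar> * ((2 * \<bar>z\<bar>) * (19 * K / (1 + x\<^sup>2)))"
    proof (intro mult_left_mono mult_mono)
      show "\<bar>y1 - y2\<bar> \<le> 2 * \<bar>z\<bar>" using y1(1) y2(1) by linarith
      have "\<bar>x - y3\<bar> \<le> 3" using y1(1) y2(1) y3(1) z by linarith
      show "\<bar>deriv (deriv w) y3\<bar> \<le> 19 * K / (1 + x\<^sup>2)"
      proof -
        \<comment> \<open>Peetre's inequality: \<open>x^2 \<le> 2 y^2 + 2 (x-y)^2\<close>.\<close>
        have "(x - y3)\<^sup>2 \<le> 3\<^sup>2" using \<open>\<bar>x - y3\<bar> \<le> 3\<close> abs_le_square_iff[of "x - y3" 3] by simp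
        moreover have "0 \<le> (x - 2 * y3)\<^sup>2" by simp
        ultimately have "x\<^sup>2 \<le> 18 + 2 * y3\<^sup>2" by (simp add: power2_diff)
        then have "1 + x\<^sup>2 \<le> 19 * (1 + y3\<^sup>2)" by (smt (verit) zero_le_power2)
        then have le: "K * (1 + x\<^sup>2) \<le> K * (19 * (1 + y3\<^sup>2))" using K0 by (rule mult_left_mono)
        have p: "0 < 1 + x\<^sup>2" "0 < 1 + y3\<^sup>2" by (simp_all add: add_pos_nonneg)
        have "K / (1 + y3\<^sup>2) \<le> 19 * K / (1 + x\<^sup>2)"
          unfolding pos_divide_le_eq[OF p(2)] times_divide_eq_left pos_le_divide_eq[OF p(1)]
          using le by (simp only: mult_ac)
        then show ?thesis using K[of y3] by linarith
      qed
    qed (use K0 in auto)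
    also have "\<dots> = 38 * K * (\<bar>z\<bar> * \<bar>z\<bar>) / (1 + x\<^sup>2)" by simp
    finally show ?thesis by (simp only: abs_mult_self_eq power2_eq_square)
  qed
  then show ?thesis by blast
qed

lemma fourier_shift:
  "(LINT x|lborel. cis (- (\<xi> * x)) * complex_of_real (w (x + z))) = cis (\<xi> * z) * fourier w \<xi>"
proof -
  let ?f = "\<lambda>x. cis (- (\<xi> * x)) * complex_of_real (w (x + z))"
  have "fourier w \<xi> = (LINT x|lborel. cis (- (\<xi> * (z + 1 * x))) * complex_of_real (w (z + 1 * x)))"
    unfolding fourier_def by (subst lborel_integral_real_affine[where c = 1 and t = z]) auto
  also have "\<dots> = (LINT x|lborel. cis (- (\<xi> * z)) * ?f x)"
    by (intro Bochner_Integration.integral_cong) (auto simp: cis_mult algebra_simps)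
  also have "\<dots> = cis (- (\<xi> * z)) * (LINT x|lborel. ?f x)" by simp
  finally have "cis (\<xi> * z) * fourier w \<xi> = (cis (\<xi> * z) * cis (- (\<xi> * z))) * (LINT x|lborel. ?f x)"
    by (simp only: mult.assoc)
  then show ?thesis by (simp add: cis_mult)
qed

lemma integrable_cis_mult:
  assumes "integrable lborel f"
  shows "integrable lborel (\<lambda>x::real. cis (- (\<xi> * x)) * complex_of_real (f x))"
proof (rule Bochner_Integration.integrable_bound[OF assms])
  have [measurable]: "f \<in> borel_measurable borel" using borel_measurable_integrable[OF assms] by simp
  have [measurable]: "cis \<in> borel_measurable borel"
    by (intro borel_measurable_continuous_onI continuous_intros)
  show "(\<lambda>x. cis (- (\<xi> * x)) * complex_of_real (f x)) \<in> borel_measurable lborel" by measurable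
qed (auto simp: norm_mult)

lemma schwartz_second_difference_integrable:
  assumes w: "schwartz w"
  shows "integrable lborel (\<lambda>x. second_difference w x z)"
proof -
  note i = schwartz_integrable[OF w]
  have "integrable lborel (\<lambda>x. w (z + 1 * x))" "integrable lborel (\<lambda>x. w (- z + 1 * x))"
    by (rule lborel_integrable_real_affine[OF i]; simp)+
  then show ?thesis using i by (simp add: second_difference_def add.commute)
qed

lemma fourier_second_difference:
  assumes w: "schwartz w"
  shows "fourier (\<lambda>x. second_difference w x z) \<xi> = complex_of_real (2 * cos (\<xi> * z) - 2) * fourier w \<xi>"
proof -
  note i = schwartz_integrable[OF w]
  have s: "integrable lborel (\<lambda>x. w (x + z))" for z
    using lborel_integrable_real_affine[OF i, of 1 z] by (simp add: add.commute)
  let ?F = "\<lambda>z. LINT x|lborel. cis (- (\<xi> * x)) * complex_of_real (w (x + z))"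
  note I = integrable_cis_mult[OF s, of \<xi>]
  have "fourier (\<lambda>x. second_difference w x z) \<xi> = (LINT x|lborel.
      cis (- (\<xi> * x)) * complex_of_real (w (x + z)) + cis (- (\<xi> * x)) * complex_of_real (w (x + (-z)))
      - 2 * (cis (- (\<xi> * x)) * complex_of_real (w (x + 0))))"
    unfolding fourier_def second_difference_def
    by (intro Bochner_Integration.integral_cong) (auto simp: algebra_simps)
  also have "\<dots> = ?F z + ?F (-z) - 2 * ?F 0"
    by (subst Bochner_Integration.integral_diff
          [OF Bochner_Integration.integrable_add[OF I[of z] I[of "-z"]] integrable_mult_right[OF I[of 0]]],
        subst Bochner_Integration.integral_add[OF I[of z] I[of "-z"]],
        subst integral_mult_right_zero, rule refl)
  also have "\<dots> = (cis (\<xi> * z) + cis (- (\<xi> * z)) - 2) * fourier w \<xi>"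
    by (simp only: fourier_shift) (simp add: algebra_simps)
  also have "cis (\<xi> * z) + cis (- (\<xi> * z)) - 2 = complex_of_real (2 * cos (\<xi> * z) - 2)"
    by (simp add: complex_eq_iff)
  finally show ?thesis .
qed

text \<open>For \<open>\<bar>z\<bar> \<le> 1\<close> the \<open>L^1\<close> norm in \<open>x\<close> of the second difference is at most a multiple of \<open>z^2\<close>, and for
  larger \<open>z\<close> at most four times the norm of \<open>w\<close>; so it is dominated by the standard majorant.\<close>

lemma levy_fubini_integrable:
  assumes \<alpha>: "0 < \<alpha>" "\<alpha> < 2" and w: "schwartz w"
  shows "integrable (lborel \<Otimes>\<^sub>M lborel)
    (\<lambda>(z, x). cis (- (\<xi> * x)) * complex_of_real (second_difference w x z / \<bar>z\<bar> powr (1 + \<alpha>)))"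
    (is "integrable _ ?f")
proof -
  note wi = schwartz_integrable[OF w]
  have [measurable]: "w \<in> borel_measurable borel" by (rule schwartz_measurable[OF w])
  have [measurable]: "cis \<in> borel_measurable borel"
    by (intro borel_measurable_continuous_onI continuous_intros)
  have meas [measurable]: "?f \<in> borel_measurable (lborel \<Otimes>\<^sub>M lborel)"
    unfolding second_difference_def by measurable
  obtain K where K: "\<And>x z. \<bar>z\<bar> \<le> 1 \<Longrightarrow> \<bar>second_difference w x z\<bar> \<le> K * z\<^sup>2 / (1 + x\<^sup>2)"
    using schwartz_second_difference_bound[OF w] by blast
  have nf: "norm (?f (z, x)) = \<bar>second_difference w x z\<bar> / \<bar>z\<bar> powr (1 + \<alpha>)" for z x
    by (simp add: norm_mult norm_divide abs_divide)
  define J where "J = (LINT x|lborel. 1 / (1 + (x::real)\<^sup>2))"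
  define N where "N = (LINT x|lborel. \<bar>w x\<bar>)"
  define C where "C = \<bar>K * J\<bar> + 4 * N"
  have N0: "0 \<le> N" unfolding N_def by simp
  have sd: "integrable lborel (\<lambda>x. \<bar>second_difference w x z\<bar>)" for z
    using schwartz_second_difference_integrable[OF w] by (rule integrable_abs)
  have L1: "(LINT x|lborel. \<bar>second_difference w x z\<bar>) \<le> C * min 1 (z\<^sup>2)" for z
  proof (cases "\<bar>z\<bar> \<le> 1")
    case True
    have "(LINT x|lborel. \<bar>second_difference w x z\<bar>) \<le> (LINT x|lborel. (K * z\<^sup>2) * (1 / (1 + x\<^sup>2)))"
      using K[OF True] by (intro integral_mono sd integrable_mult_right integrable_inverse_one_plus_square) auto
    also have "\<dots> = (K * J) * z\<^sup>2" by (subst integral_mult_right_zero) (simp add: J_def)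
    also have "\<dots> \<le> C * z\<^sup>2" using N0 by (intro mult_right_mono) (auto simp: C_def)
    finally show ?thesis using True by (simp add: min_absorb2 abs_square_le_1)
  next
    case False
    have s: "integrable lborel (\<lambda>x. \<bar>w (x + t)\<bar>)" "(LINT x|lborel. \<bar>w (x + t)\<bar>) = N" for t
      using lborel_integrable_real_affine[OF integrable_abs[OF wi], of 1 t]
        lborel_integral_real_affine[of 1 "\<lambda>x. \<bar>w x\<bar>" t] by (simp_all add: add.commute N_def)
    have "(LINT x|lborel. \<bar>second_difference w x z\<bar>)
        \<le> (LINT x|lborel. \<bar>w (x + z)\<bar> + \<bar>w (x + (-z))\<bar> + 2 * \<bar>w (x + 0)\<bar>)"
      by (intro integral_mono sd Bochner_Integration.integrable_add integrable_mult_right s)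
         (auto simp: second_difference_def)
    also have "\<dots> = (LINT x|lborel. \<bar>w (x + z)\<bar>) + (LINT x|lborel. \<bar>w (x + (-z))\<bar>) + 2 * (LINT x|lborel. \<bar>w (x + 0)\<bar>)"
      using s(1)[of z] s(1)[of "-z"] s(1)[of 0] by simp
    also have "\<dots> = 4 * N" by (simp only: s)
    also have "\<dots> \<le> C" by (simp add: C_def)
    finally have le: "(LINT x|lborel. \<bar>second_difference w x z\<bar>) \<le> C" .
    have "1 \<le> z\<^sup>2" using False abs_square_less_1[of z] by linarith
    then show ?thesis using le by (simp add: min_absorb1)
  qed
  show ?thesis
  proof (rule lborel_pair.Fubini_integrable[OF meas])
    have eq: "(LINT x|lborel. norm (?f (z, x))) = (LINT x|lborel. \<bar>second_difference w x z\<bar>) / \<bar>z\<bar> powr (1 + \<alpha>)" for z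
      unfolding nf by simp
    show "integrable lborel (\<lambda>z. LINT x|lborel. norm (?f (z, x)))"
    proof (rule Bochner_Integration.integrable_bound)
      show "integrable lborel (\<lambda>z. C * (min 1 (z\<^sup>2) / \<bar>z\<bar> powr (1 + \<alpha>)))"
        using levy_majorant_integrable[OF \<alpha>] by (rule integrable_mult_right)
      have "(\<lambda>p. norm (?f p)) \<in> borel_measurable (lborel \<Otimes>\<^sub>M lborel)"
        by (rule measurable_compose[OF meas borel_measurable_norm])
      then show "(\<lambda>z. LINT x|lborel. norm (?f (z, x))) \<in> borel_measurable lborel"
        by (intro lborel.borel_measurable_lebesgue_integral) (simp add: case_prod_beta')
      show "AE z in lborel. norm (LINT x|lborel. norm (?f (z, x))) \<le> norm (C * (min 1 (z\<^sup>2) / \<bar>z\<bar> powr (1 + \<alpha>)))"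
      proof (rule AE_I2)
        fix z :: real
        have "(LINT x|lborel. \<bar>second_difference w x z\<bar>) / \<bar>z\<bar> powr (1 + \<alpha>) \<le> C * min 1 (z\<^sup>2) / \<bar>z\<bar> powr (1 + \<alpha>)"
          using L1 by (intro divide_right_mono) auto
        moreover have "0 \<le> (LINT x|lborel. \<bar>second_difference w x z\<bar>) / \<bar>z\<bar> powr (1 + \<alpha>)" by simp
        ultimately show "norm (LINT x|lborel. norm (?f (z, x))) \<le> norm (C * (min 1 (z\<^sup>2) / \<bar>z\<bar> powr (1 + \<alpha>)))"
          unfolding eq real_norm_def by (simp only: times_divide_eq_right) linarith
      qed
    qed
    show "AE z in lborel. integrable lborel (\<lambda>x. ?f (z, x))"
      unfolding split_conv
      by (intro AE_I2 integrable_cis_mult integrable_divide schwartz_second_difference_integrable[OF w])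
  qed
qed

text \<open>Minus the Fourier multiplier of the Levy integral.\<close>

definition levy_symbol :: "real \<Rightarrow> real \<Rightarrow> real" where
  "levy_symbol \<alpha> \<xi> = (LINT z|lborel. (1 - cos (\<xi> * z)) / \<bar>z\<bar> powr (1 + \<alpha>))"

text \<open>After exchanging the integrals, the inner one is the Fourier transform of a second difference,
  in which each shift by \<open>z\<close> is a multiplication by a character.\<close>

lemma fourier_levy_integral:
  assumes \<alpha>: "0 < \<alpha>" "\<alpha> < 2" and w: "schwartz w"
  shows "fourier (levy_integral \<alpha> w) \<xi> = - complex_of_real (levy_symbol \<alpha> \<xi>) * fourier w \<xi>"
proof -
  let ?k = "\<lambda>z. \<bar>z\<bar> powr (1 + \<alpha>)"
  let ?f = "\<lambda>z x. cis (- (\<xi> * x)) * complex_of_real (second_difference w x z / ?k z)"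
  have F: "integrable (lborel \<Otimes>\<^sub>M lborel) (\<lambda>(z, x). ?f z x)"
    using levy_fubini_integrable[OF \<alpha> w, of \<xi>] .
  have "2 * fourier (levy_integral \<alpha> w) \<xi>
      = (LINT x|lborel. 2 * (cis (- (\<xi> * x)) * complex_of_real (levy_integral \<alpha> w x)))"
    unfolding fourier_def by simp
  also have "\<dots> = (LINT x|lborel. LINT z|lborel. ?f z x)"
  proof (rule Bochner_Integration.integral_cong)
    fix x
    have "levy_integral \<alpha> w x = (LINT z|lborel. second_difference w x z / ?k z) / 2"
      by (rule levy_integral_second_difference(2)[OF schwartz_levy_integrand_integrable[OF \<alpha> w]])
    then have "(LINT z|lborel. second_difference w x z / ?k z) = 2 * levy_integral \<alpha> w x" by simp
    then have "2 * (cis (- (\<xi> * x)) * complex_of_real (levy_integral \<alpha> w x))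
        = cis (- (\<xi> * x)) * complex_of_real (LINT z|lborel. second_difference w x z / ?k z)" by simp
    also have "\<dots> = (LINT z|lborel. ?f z x)"
      by (subst integral_complex_of_real[symmetric], subst integral_mult_right_zero[symmetric]) simp
    finally show "2 * (cis (- (\<xi> * x)) * complex_of_real (levy_integral \<alpha> w x)) = (LINT z|lborel. ?f z x)" .
  qed simp
  also have "\<dots> = (LINT z|lborel. LINT x|lborel. ?f z x)"
    by (rule lborel_pair.Fubini_integral[OF F])
  also have "\<dots> = (LINT z|lborel. complex_of_real (- 2 * ((1 - cos (\<xi> * z)) / ?k z)) * fourier w \<xi>)"
  proof (rule Bochner_Integration.integral_cong)
    fix z
    have "(LINT x|lborel. ?f z x) = fourier (\<lambda>x. second_difference w x z) \<xi> / complex_of_real (?k z)"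
      unfolding fourier_def by simp
    also have "\<dots> = complex_of_real (- 2 * ((1 - cos (\<xi> * z)) / ?k z)) * fourier w \<xi>"
      unfolding fourier_second_difference[OF w] by (simp add: algebra_simps diff_divide_distrib)
    finally show "(LINT x|lborel. ?f z x) = complex_of_real (- 2 * ((1 - cos (\<xi> * z)) / ?k z)) * fourier w \<xi>" .
  qed simp
  also have "\<dots> = complex_of_real (- 2 * levy_symbol \<alpha> \<xi>) * fourier w \<xi>"
    unfolding levy_symbol_def
    by (simp only: integral_mult_left_zero integral_complex_of_real integral_mult_right_zero)
  also have "complex_of_real (- 2 * levy_symbol \<alpha> \<xi>) = 2 * - complex_of_real (levy_symbol \<alpha> \<xi>)" by simp
  finally have "2 * fourier (levy_integral \<alpha> w) \<xi>
      = 2 * (- complex_of_real (levy_symbol \<alpha> \<xi>) * fourier w \<xi>)"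
    by (simp only: mult.assoc)
  then show ?thesis by (rule iffD1[OF mult_left_cancel, rotated]) simp
qed

text \<open>Substitute \<open>\<xi>z\<close> for \<open>z\<close>.\<close>

lemma levy_symbol_homogeneous:
  assumes "0 < \<alpha>"
  shows "levy_symbol \<alpha> \<xi> = \<bar>\<xi>\<bar> powr \<alpha> * levy_symbol \<alpha> 1"
proof (cases "\<xi> = 0")
  case False
  have "levy_symbol \<alpha> 1 = \<bar>\<xi>\<bar> * (LINT z|lborel. (1 - cos (1 * (0 + \<xi> * z))) / \<bar>0 + \<xi> * z\<bar> powr (1 + \<alpha>))"
    unfolding levy_symbol_def by (subst lborel_integral_real_affine[where c = \<xi> and t = 0]) (use False in auto)
  also have "(LINT z|lborel. (1 - cos (1 * (0 + \<xi> * z))) / \<bar>0 + \<xi> * z\<bar> powr (1 + \<alpha>))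
      = (LINT z|lborel. (1 / \<bar>\<xi>\<bar> powr (1 + \<alpha>)) * ((1 - cos (\<xi> * z)) / \<bar>z\<bar> powr (1 + \<alpha>)))"
    by (intro Bochner_Integration.integral_cong) (auto simp: abs_mult powr_mult)
  also have "\<dots> = levy_symbol \<alpha> \<xi> / \<bar>\<xi>\<bar> powr (1 + \<alpha>)"
    by (subst integral_mult_right_zero) (simp add: levy_symbol_def)
  finally show ?thesis using False by (simp add: powr_add)
qed (use assms in \<open>simp add: levy_symbol_def\<close>)

text \<open>The integrand is nonnegative, and bounded below by a positive constant on \<open>[1,2]\<close>.\<close>

lemma levy_symbol_pos:
  assumes \<alpha>: "0 < \<alpha>" "\<alpha> < 2"
  shows "0 < levy_symbol \<alpha> 1"
proof -
  let ?f = "\<lambda>z::real. (1 - cos (1 * z)) / \<bar>z\<bar> powr (1 + \<alpha>)"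
  have int: "integrable lborel ?f"
  proof (rule Bochner_Integration.integrable_bound)
    show "integrable lborel (\<lambda>z. 2 * (min 1 (z\<^sup>2) / \<bar>z\<bar> powr (1 + \<alpha>)))"
      using levy_majorant_integrable[OF \<alpha>] by (rule integrable_mult_right)
    have b: "1 - cos z \<le> 2 * min 1 (z\<^sup>2)" for z :: real
    proof -
      have "1 - cos z = 2 * (sin (z / 2))\<^sup>2" using cos_double_sin[of "z / 2"] by simp
      moreover have "(sin (z / 2))\<^sup>2 \<le> (z / 2)\<^sup>2" using abs_sin_x_le_abs_x[of "z / 2"] abs_le_square_iff by blast
      moreover have "(z / 2)\<^sup>2 \<le> z\<^sup>2" by (simp add: power_divide)
      moreover have "(sin (z / 2))\<^sup>2 \<le> 1" by (simp add: abs_square_le_1)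
      ultimately show ?thesis by (simp add: min_def)
    qed
    show "AE z in lborel. norm (?f z) \<le> norm (2 * (min 1 (z\<^sup>2) / \<bar>z\<bar> powr (1 + \<alpha>)))"
      by (rule AE_I2) (use b in \<open>auto simp: abs_divide intro!: divide_right_mono\<close>)
  qed measurable
  define c where "c = (1 - cos 1) / 2 powr (1 + \<alpha>)"
  have "cos 1 < cos (0::real)" using pi_gt3 by (intro cos_monotone_0_pi) auto
  then have c: "0 < c" by (simp add: c_def)
  have "(LINT z|lborel. c * indicat_real {1..2::real} z) \<le> levy_symbol \<alpha> 1" unfolding levy_symbol_def
  proof (intro integral_mono int)
    fix z :: real
    show "c * indicat_real {1..2} z \<le> ?f z"
    proof (cases "z \<in> {1..2}")
      case True
      then have "cos z \<le> cos 1" using pi_gt3 by (intro cos_monotone_0_pi_le) auto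
      moreover have "z powr (1 + \<alpha>) \<le> 2 powr (1 + \<alpha>)" using True \<alpha> by (intro powr_mono2) auto
      ultimately have "c \<le> ?f z" unfolding c_def using True by (intro frac_le) auto
      then show ?thesis using True by simp
    qed auto
  qed auto
  then show ?thesis using c by simp
qed

lemma power_le_fact_exp:
  fixes y :: real
  assumes "0 \<le> y"
  shows "y ^ n \<le> fact n * exp y"
proof -
  have "(\<Sum>k\<in>{n}. inverse (fact k) * y ^ k) \<le> (\<Sum>k. inverse (fact k) * y ^ k)"
    using summable_exp[of y] assms by (intro sum_le_suminf) auto
  then have "inverse (fact n) * y ^ n \<le> exp y" by (simp add: exp_def)
  then show ?thesis by (simp add: field_simps)
qed

text \<open>Bound \<open>\<bar>x\<bar>^m\<close> by \<open>1 + x^(2m)\<close> and apply \<open>y^m \<le> m! exp y\<close> to \<open>y = x^2/2\<close>.\<close>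

lemma bounded_power_mult_gaussian:
  "bounded (range (\<lambda>x::real. x ^ m * exp (- x\<^sup>2 / 2)))"
proof -
  have "\<bar>x ^ m * exp (- x\<^sup>2 / 2)\<bar> \<le> 1 + 2 ^ m * fact m" for x :: real
  proof -
    let ?e = "exp (- x\<^sup>2 / 2)"
    have e1: "?e \<le> 1" by simp
    have "\<bar>x ^ m\<bar> \<le> 1 + (x ^ m)\<^sup>2"
    proof -
      have "0 \<le> (\<bar>x ^ m\<bar> - 1)\<^sup>2" "0 \<le> (x ^ m)\<^sup>2" by simp_all
      then show ?thesis unfolding power2_diff by simp
    qed
    also have "(x ^ m)\<^sup>2 = 2 ^ m * (x\<^sup>2 / 2) ^ m"
      by (simp add: power_mult_distrib[symmetric] power_mult[symmetric] mult.commute)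
    finally have "\<bar>x ^ m\<bar> * ?e \<le> (1 + 2 ^ m * (x\<^sup>2 / 2) ^ m) * ?e" by (rule mult_right_mono) simp
    also have "\<dots> = ?e + 2 ^ m * ((x\<^sup>2 / 2) ^ m * ?e)" by (simp add: algebra_simps)
    also have "\<dots> \<le> 1 + 2 ^ m * fact m"
    proof (intro add_mono e1 mult_left_mono)
      have "(x\<^sup>2 / 2) ^ m * ?e \<le> (fact m * exp (x\<^sup>2 / 2)) * ?e"
        by (intro mult_right_mono power_le_fact_exp) auto
      also have "\<dots> = fact m" by (simp add: exp_minus field_simps)
      finally show "(x\<^sup>2 / 2) ^ m * ?e \<le> fact m" .
    qed simp
    finally show ?thesis by (simp add: abs_mult)
  qed
  then show ?thesis by (auto simp: bounded_iff)
qed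

lemma bounded_poly_mult_gaussian:
  "bounded (range (\<lambda>x::real. x ^ m * (poly p x * exp (- x\<^sup>2 / 2))))"
proof (induction p arbitrary: m)
  case 0
  then show ?case by (simp add: image_constant_conv)
next
  case (pCons a p)
  have "bounded (range (\<lambda>x::real. a *\<^sub>R (x ^ m * exp (- x\<^sup>2 / 2)) + x ^ Suc m * (poly p x * exp (- x\<^sup>2 / 2))))"
    by (intro bounded_plus_comp bounded_scaleR_comp bounded_power_mult_gaussian pCons.IH)
  then show ?case by (simp add: algebra_simps)
qed

text \<open>Every derivative of a Gaussian is a polynomial times the Gaussian.\<close>

lemma schwartz_gaussian: "schwartz std_normal_density"
proof -
  let ?e = "\<lambda>x::real. exp (- x\<^sup>2 / 2)"
  have der: "((\<lambda>x. poly p x * ?e x) has_real_derivative poly (pderiv p - [:0, 1:] * p) x * ?e x) (at x)" for p x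
    by (auto intro!: derivative_eq_intros simp: algebra_simps)
  have "\<exists>p. (deriv ^^ k) std_normal_density = (\<lambda>x. poly p x * ?e x)" for k
  proof (induction k)
    case 0
    show ?case by (intro exI[of _ "[:1 / sqrt (2 * pi):]"]) (auto simp: std_normal_density_def)
  next
    case (Suc k)
    then obtain p where "(deriv ^^ k) std_normal_density = (\<lambda>x. poly p x * ?e x)" by blast
    moreover have "deriv (\<lambda>x. poly p x * ?e x) = (\<lambda>x. poly (pderiv p - [:0, 1:] * p) x * ?e x)"
      by (rule ext) (rule DERIV_imp_deriv[OF der])
    ultimately have "(deriv ^^ Suc k) std_normal_density = (\<lambda>x. poly (pderiv p - [:0, 1:] * p) x * ?e x)"
      by (simp only: funpow.simps comp_apply)
    then show ?case by blast
  qed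
  then obtain p where p: "\<And>k. (deriv ^^ k) std_normal_density = (\<lambda>x. poly (p k) x * ?e x)" by metis
  show ?thesis
    unfolding schwartz_def p
  proof (intro conjI allI)
    show "(\<lambda>x. poly (p k) x * ?e x) differentiable at x" for k x
      using der[of "p k" x] real_differentiable_def by blast
    show "bounded (range (\<lambda>x. x ^ m * (poly (p k) x * ?e x)))" for m k
      by (rule bounded_poly_mult_gaussian)
  qed
qed

lemma fourier_gaussian: "fourier std_normal_density \<xi> = complex_of_real (exp (- \<xi>\<^sup>2 / 2))"
proof -
  have "complex_of_real (exp (- (-\<xi>)\<^sup>2 / 2)) = char std_normal_distribution (-\<xi>)"
    by (simp only: char_std_normal_distribution)
  also have "\<dots> = (CLINT x|lborel. std_normal_density x *\<^sub>R iexp (- \<xi> * x))"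
    unfolding char_def by (subst integral_density) auto
  also have "\<dots> = fourier std_normal_density \<xi>" unfolding fourier_def
    by (intro Bochner_Integration.integral_cong) (auto simp: cis_conv_exp scaleR_conv_of_real mult_ac)
  finally show ?thesis by simp
qed

text \<open>Uniqueness needs a single Schwartz function whose Fourier transform does not vanish at some
  nonzero frequency; the Gaussian at frequency 1 serves.\<close>

lemma levy_const_eq:
  assumes \<alpha>: "0 < \<alpha>" "\<alpha> < 2"
  shows "levy_const \<alpha> = 1 / levy_symbol \<alpha> 1"
  unfolding levy_const_def
proof (rule the_equality)
  have scale: "fourier (\<lambda>x. - (C * levy_integral \<alpha> w x)) \<xi>
      = complex_of_real (C * \<bar>\<xi>\<bar> powr \<alpha> * levy_symbol \<alpha> 1) * fourier w \<xi>" if "schwartz w" for C w \<xi>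
  proof -
    have "fourier (\<lambda>x. - (C * levy_integral \<alpha> w x)) \<xi>
        = (LINT x|lborel. complex_of_real (- C) * (cis (- (\<xi> * x)) * complex_of_real (levy_integral \<alpha> w x)))"
      unfolding fourier_def by (intro Bochner_Integration.integral_cong) auto
    also have "\<dots> = complex_of_real (- C) * fourier (levy_integral \<alpha> w) \<xi>"
      unfolding fourier_def by (rule integral_mult_right_zero)
    also have "\<dots> = complex_of_real (C * levy_symbol \<alpha> \<xi>) * fourier w \<xi>"
      unfolding fourier_levy_integral[OF \<alpha> that] by simp
    finally show ?thesis by (simp only: levy_symbol_homogeneous[OF \<alpha>(1), of \<xi>] mult.assoc)
  qed
  show "0 < 1 / levy_symbol \<alpha> 1 \<and> (\<forall>w. schwartz w \<longrightarrow> (\<forall>\<xi>. fourier (\<lambda>x. - (1 / levy_symbol \<alpha> 1 * levy_integral \<alpha> w x)) \<xi>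
             = complex_of_real (\<bar>\<xi>\<bar> powr \<alpha>) * fourier w \<xi>))"
  proof (intro conjI allI impI)
    fix w \<xi> assume "schwartz w"
    then show "fourier (\<lambda>x. - (1 / levy_symbol \<alpha> 1 * levy_integral \<alpha> w x)) \<xi>
             = complex_of_real (\<bar>\<xi>\<bar> powr \<alpha>) * fourier w \<xi>"
      using scale[of w "1 / levy_symbol \<alpha> 1" \<xi>] levy_symbol_pos[OF \<alpha>] by simp
  qed (use levy_symbol_pos[OF \<alpha>] in simp)
  fix C assume C: "C > 0 \<and> (\<forall>w. schwartz w \<longrightarrow> (\<forall>\<xi>. fourier (\<lambda>x. - (C * levy_integral \<alpha> w x)) \<xi>
             = complex_of_real (\<bar>\<xi>\<bar> powr \<alpha>) * fourier w \<xi>))"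
  then have "fourier (\<lambda>x. - (C * levy_integral \<alpha> std_normal_density x)) 1
      = complex_of_real (\<bar>1\<bar> powr \<alpha>) * fourier std_normal_density 1"
    using schwartz_gaussian by blast
  then have "complex_of_real (C * levy_symbol \<alpha> 1) = 1"
    unfolding scale[OF schwartz_gaussian] fourier_gaussian by simp
  then have "C * levy_symbol \<alpha> 1 = 1" using of_real_eq_1_iff by blast
  then show "C = 1 / levy_symbol \<alpha> 1" using levy_symbol_pos[OF \<alpha>] by (simp add: field_simps)
qed

lemma levy_const_pos:
  assumes "0 < \<alpha>" "\<alpha> < 2"
  shows "0 < levy_const \<alpha>"
  using levy_symbol_pos[OF assms] by (simp add: levy_const_eq[OF assms])

section \<open>The profile and its primitive\<close>

text \<open>The cutoff makes the base nonnegative, and \<open>0 powr \<gamma> = 0\<close> extends the profile by zero.\<close>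

definition profile :: "real \<Rightarrow> real \<Rightarrow> real" where
  "profile \<gamma> x = (max 0 (1 - x\<^sup>2)) powr \<gamma>"

lemma profile_inside: "\<bar>x\<bar> \<le> 1 \<Longrightarrow> profile \<gamma> x = (1 - x\<^sup>2) powr \<gamma>"
  by (simp add: profile_def abs_square_le_1)

lemma profile_outside: "1 \<le> \<bar>x\<bar> \<Longrightarrow> profile \<gamma> x = 0"
  using abs_square_less_1[of x] by (auto simp: profile_def max_def)

lemma profile_nonneg: "0 \<le> profile \<gamma> x"
  by (simp add: profile_def)

lemma profile_pos: "\<bar>x\<bar> < 1 \<Longrightarrow> 0 < profile \<gamma> x"
  using abs_square_less_1[of x] by (auto simp: profile_inside)

lemma profile_minus [simp]: "profile \<gamma> (- x) = profile \<gamma> x"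
  by (simp add: profile_def)

lemma profile_le_one: "0 \<le> \<gamma> \<Longrightarrow> profile \<gamma> x \<le> 1"
  unfolding profile_def by (rule powr_le1) auto

lemma continuous_on_profile [continuous_intros]:
  assumes "0 < \<gamma>"
  shows "continuous_on S (profile \<gamma>)"
  unfolding profile_def using assms by (intro continuous_on_powr' continuous_intros) auto

text \<open>Subadditivity of the concave power: divided by \<open>a\<close>, the numbers \<open>b\<close> and \<open>a - b\<close> become weights
  \<open>t\<close> in \<open>[0,1]\<close> of sum one, and \<open>t \<le> t powr \<gamma>\<close>.\<close>

lemma powr_diff_le_powr:
  fixes a b :: real
  assumes "0 \<le> b" "b \<le> a" "0 < \<gamma>" "\<gamma> \<le> 1"
  shows "a powr \<gamma> - b powr \<gamma> \<le> (a - b) powr \<gamma>"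
proof (cases "a = 0")
  case False
  with assms have a: "0 < a" by simp
  have low: "t \<le> t powr \<gamma>" if "0 \<le> t" "t \<le> 1" for t :: real
    using that assms powr_mono'[of \<gamma> 1 t] by simp
  have "a powr \<gamma> = a powr \<gamma> * (b / a + (a - b) / a)" using a by (simp add: diff_divide_distrib)
  also have "\<dots> \<le> a powr \<gamma> * ((b / a) powr \<gamma> + ((a - b) / a) powr \<gamma>)"
    using a assms by (intro mult_left_mono add_mono low) auto
  also have "\<dots> = b powr \<gamma> + (a - b) powr \<gamma>"
    using a assms by (simp add: powr_divide distrib_left)
  finally show ?thesis by simp
qed (use assms in auto)

text \<open>The truncated parabola is Lipschitz with constant 2, and the power is Hoelder continuous.\<close>

lemma profile_holder:
  assumes "0 < \<gamma>" "\<gamma> \<le> 1"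
  shows "\<bar>profile \<gamma> x - profile \<gamma> y\<bar> \<le> 2 powr \<gamma> * \<bar>x - y\<bar> powr \<gamma>"
proof -
  have clip: "max 0 (1 - x\<^sup>2) - max 0 (1 - y\<^sup>2) \<le> 2 * \<bar>x - y\<bar>" for x y :: real
  proof (cases "\<bar>x\<bar> \<le> 1")
    case True
    then have x: "max 0 (1 - x\<^sup>2) = 1 - x\<^sup>2" by (simp add: abs_square_le_1)
    show ?thesis
    proof (cases "\<bar>y\<bar> \<le> 1")
      case y: True
      have "1 - x\<^sup>2 - (1 - y\<^sup>2) = (y + x) * (y - x)" by (simp add: power2_eq_square algebra_simps)
      also have "\<dots> \<le> \<bar>y + x\<bar> * \<bar>y - x\<bar>" by (metis abs_ge_self abs_mult)
      also have "\<dots> \<le> 2 * \<bar>y - x\<bar>" using True y by (intro mult_right_mono) auto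
      finally have "1 - x\<^sup>2 - (1 - y\<^sup>2) \<le> 2 * \<bar>x - y\<bar>" by (simp add: abs_minus_commute)
      moreover have "max 0 (1 - y\<^sup>2) = 1 - y\<^sup>2" using y by (simp add: abs_square_le_1)
      ultimately show ?thesis using x by simp
    next
      case False
      have "1 - x\<^sup>2 = (1 + \<bar>x\<bar>) * (1 - \<bar>x\<bar>)" by (simp add: power2_eq_square algebra_simps)
      also have "\<dots> \<le> 2 * (1 - \<bar>x\<bar>)" using True by (intro mult_right_mono) auto
      also have "\<dots> \<le> 2 * \<bar>x - y\<bar>" using False by (intro mult_left_mono) linarith+
      finally show ?thesis using x by (smt (verit) max.cobounded1)
    qed
  next
    case False
    then have "\<not> x\<^sup>2 \<le> 1" by (simp add: abs_square_le_1)
    then have "max 0 (1 - x\<^sup>2) = 0" by simp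
    then show ?thesis by (smt (verit) max.cobounded1)
  qed
  have one: "profile \<gamma> x - profile \<gamma> y \<le> 2 powr \<gamma> * \<bar>x - y\<bar> powr \<gamma>" for x y
  proof (cases "max 0 (1 - y\<^sup>2) \<le> max 0 (1 - x\<^sup>2)")
    case True
    have "profile \<gamma> x - profile \<gamma> y \<le> (max 0 (1 - x\<^sup>2) - max 0 (1 - y\<^sup>2)) powr \<gamma>"
      unfolding profile_def using assms True by (intro powr_diff_le_powr) auto
    also have "\<dots> \<le> (2 * \<bar>x - y\<bar>) powr \<gamma>" using True clip assms by (intro powr_mono2) auto
    finally show ?thesis by (simp add: powr_mult)
  next
    case False
    then have "profile \<gamma> x \<le> profile \<gamma> y" unfolding profile_def using assms by (intro powr_mono2) auto
    then show ?thesis by (smt (verit) mult_nonneg_nonneg powr_ge_zero)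
  qed
  show ?thesis using one[of x y] one[of y x] by (simp add: abs_le_iff abs_minus_commute)
qed

lemma profile_has_derivative:
  assumes "\<bar>x\<bar> < 1"
  shows "(profile \<gamma> has_real_derivative \<gamma> * (1 - x\<^sup>2) powr (\<gamma> - 1) * (- 2 * x)) (at x)"
proof (rule DERIV_cong_ev[THEN iffD1, OF refl _ refl])
  have "eventually (\<lambda>y. y \<in> {-1<..<1::real}) (nhds x)"
    using assms by (intro eventually_nhds_in_open) auto
  then show "\<forall>\<^sub>F y in nhds x. (1 - y\<^sup>2) powr \<gamma> = profile \<gamma> y"
    by eventually_elim (auto simp: profile_inside abs_le_iff)
  have "0 < 1 - x\<^sup>2" using assms by (simp add: abs_square_less_1)
  then show "((\<lambda>y. (1 - y\<^sup>2) powr \<gamma>) has_real_derivative \<gamma> * (1 - x\<^sup>2) powr (\<gamma> - 1) * (- 2 * x)) (at x)"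
    by (auto intro!: derivative_eq_intros)
qed

text \<open>The derivative of the profile blows up only at the end points of \<open>[-1,1]\<close>.\<close>

lemma profile_locally_lipschitz:
  assumes \<gamma>: "0 < \<gamma>" "\<gamma> \<le> 1" and r: "r < 1" "\<bar>x\<bar> \<le> r" "\<bar>y\<bar> \<le> r"
  shows "\<bar>profile \<gamma> x - profile \<gamma> y\<bar> \<le> 2 * \<gamma> * (1 - r\<^sup>2) powr (\<gamma> - 1) * \<bar>x - y\<bar>"
proof -
  have r0: "0 \<le> r" using r by linarith
  have "norm (profile \<gamma> x - profile \<gamma> y) \<le> (2 * \<gamma> * (1 - r\<^sup>2) powr (\<gamma> - 1)) * norm (x - y)"
  proof (rule field_differentiable_bound[where S = "{-r..r}"])
    fix z assume z: "z \<in> {-r..r}"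
    then have z': "\<bar>z\<bar> \<le> r" by auto
    then show "(profile \<gamma> has_field_derivative \<gamma> * (1 - z\<^sup>2) powr (\<gamma> - 1) * (- 2 * z)) (at z within {-r..r})"
      using r by (intro has_field_derivative_at_within[OF profile_has_derivative]) auto
    have "z\<^sup>2 \<le> r\<^sup>2" using z' r0 abs_le_square_iff[of z r] by simp
    moreover have "r\<^sup>2 < 1" using r r0 by (simp add: abs_square_less_1)
    ultimately have "(1 - z\<^sup>2) powr (\<gamma> - 1) \<le> (1 - r\<^sup>2) powr (\<gamma> - 1)"
      using \<gamma> by (intro powr_mono2') auto
    then have "\<gamma> * ((1 - z\<^sup>2) powr (\<gamma> - 1) * (2 * \<bar>z\<bar>)) \<le> \<gamma> * ((1 - r\<^sup>2) powr (\<gamma> - 1) * 2)"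
      using \<gamma> z' r by (intro mult_left_mono mult_mono) auto
    then show "norm (\<gamma> * (1 - z\<^sup>2) powr (\<gamma> - 1) * (- 2 * z)) \<le> 2 * \<gamma> * (1 - r\<^sup>2) powr (\<gamma> - 1)"
      using \<gamma> by (simp add: abs_mult mult_ac)
  qed (use r in auto)
  then show ?thesis by simp
qed

definition profile_primitive :: "real \<Rightarrow> real \<Rightarrow> real" where
  "profile_primitive \<gamma> x = integral {-1..x} (profile \<gamma>)"

definition profile_mass :: "real \<Rightarrow> real" where
  "profile_mass \<gamma> = integral {-1..1} (profile \<gamma>)"

context
  fixes \<gamma> :: real
  assumes \<gamma>: "0 < \<gamma>"
begin

lemma profile_integrable: "profile \<gamma> integrable_on {a..b}"
  by (intro integrable_continuous_interval continuous_on_profile \<gamma>)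

lemma profile_primitive_left: "x \<le> -1 \<Longrightarrow> profile_primitive \<gamma> x = 0"
  by (cases "x = -1") (auto simp: profile_primitive_def)

text \<open>Around \<open>x = -1\<close> the primitive agrees with the integral from \<open>-2\<close>, to which the fundamental theorem
  applies in the interior of its interval.\<close>

lemma has_derivative_profile_primitive:
  "(profile_primitive \<gamma> has_real_derivative profile \<gamma> x) (at x)"
proof (cases "x < -1")
  case True
  have ev: "\<forall>\<^sub>F y in nhds x. 0 = profile_primitive \<gamma> y"
    using True by (intro eventually_mono[OF eventually_nhds_in_open[of "{..<-1}"]])
      (auto simp: profile_primitive_left)
  have "((\<lambda>_. 0) has_real_derivative profile \<gamma> x) (at x)" using True by (simp add: profile_outside)
  then show ?thesis using DERIV_cong_ev[THEN iffD1, OF refl ev refl] by blast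
next
  case False
  have z: "integral {-2..-1} (profile \<gamma>) = 0"
    by (rule integral_unique, rule has_integral_eq[of _ "\<lambda>_. 0"]) (auto simp: profile_outside)
  have eq: "profile_primitive \<gamma> y = integral {-2..y} (profile \<gamma>)" if y: "-2 < y" for y
  proof (cases "y < -1")
    case True
    have "integral {-2..y} (profile \<gamma>) = 0"
      by (rule integral_unique, rule has_integral_eq[of _ "\<lambda>_. 0"]) (use True in \<open>auto simp: profile_outside\<close>)
    then show ?thesis using True by (simp add: profile_primitive_left)
  next
    case False
    then have "integral {-2..-1} (profile \<gamma>) + integral {-1..y} (profile \<gamma>) = integral {-2..y} (profile \<gamma>)"
      by (intro Henstock_Kurzweil_Integration.integral_combine profile_integrable) auto
    then show ?thesis using z by (simp add: profile_primitive_def)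
  qed
  have "((\<lambda>y. integral {-2..y} (profile \<gamma>)) has_real_derivative profile \<gamma> x) (at x within {-2..x+1})"
    using False by (intro integral_has_real_derivative continuous_on_profile \<gamma>) auto
  then have d: "((\<lambda>y. integral {-2..y} (profile \<gamma>)) has_real_derivative profile \<gamma> x) (at x)"
    using False by (subst (asm) at_within_interior) auto
  have ev: "\<forall>\<^sub>F y in nhds x. integral {-2..y} (profile \<gamma>) = profile_primitive \<gamma> y"
    using False by (intro eventually_mono[OF eventually_nhds_in_open[of "{-2<..}"]]) (auto simp: eq)
  show ?thesis using DERIV_cong_ev[THEN iffD1, OF refl ev refl d] .
qed

lemma mono_profile_primitive: "mono (profile_primitive \<gamma>)"
  by (rule monoI) (meson DERIV_nonneg_imp_nondecreasing has_derivative_profile_primitive profile_nonneg)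

lemma profile_primitive_right: "1 \<le> x \<Longrightarrow> profile_primitive \<gamma> x = profile_mass \<gamma>"
proof -
  assume x: "1 \<le> x"
  have "integral {1..x} (profile \<gamma>) = 0"
    by (rule integral_unique, rule has_integral_eq[of _ "\<lambda>_. 0"]) (auto simp: profile_outside)
  moreover have "integral {-1..1} (profile \<gamma>) + integral {1..x} (profile \<gamma>) = integral {-1..x} (profile \<gamma>)"
    using x by (intro Henstock_Kurzweil_Integration.integral_combine profile_integrable) auto
  ultimately show ?thesis by (simp add: profile_primitive_def profile_mass_def)
qed

lemma profile_primitive_reflect: "profile_primitive \<gamma> (- x) = profile_mass \<gamma> - profile_primitive \<gamma> x"
proof -
  have d: "((\<lambda>x. profile_primitive \<gamma> x + profile_primitive \<gamma> (- x)) has_real_derivative 0) (at x)" for x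
    by (rule derivative_eq_intros DERIV_chain2[OF has_derivative_profile_primitive] has_derivative_profile_primitive refl)+ simp
  have "profile_primitive \<gamma> x + profile_primitive \<gamma> (- x) = profile_primitive \<gamma> 1 + profile_primitive \<gamma> (- 1)"
    using d by (intro DERIV_isconst_all) auto
  then show ?thesis using profile_primitive_left[of "-1"] profile_primitive_right[of 1] by simp
qed

lemma profile_mass_pos: "0 < profile_mass \<gamma>"
proof -
  have "profile_primitive \<gamma> (-1) < profile_primitive \<gamma> 1"
    by (rule DERIV_pos_imp_increasing_open)
       (auto intro!: exI has_derivative_profile_primitive profile_pos
          DERIV_isCont continuous_at_imp_continuous_on)
  then show ?thesis by (simp add: profile_primitive_left profile_primitive_right)
qed

lemma profile_primitive_bounds: "0 \<le> profile_primitive \<gamma> x" "profile_primitive \<gamma> x \<le> profile_mass \<gamma>"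
proof -
  have "profile_primitive \<gamma> (min x (-1)) \<le> profile_primitive \<gamma> x"
    by (intro monoD[OF mono_profile_primitive]) auto
  then show "0 \<le> profile_primitive \<gamma> x" by (simp add: profile_primitive_left)
  have "profile_primitive \<gamma> x \<le> profile_primitive \<gamma> (max x 1)"
    by (intro monoD[OF mono_profile_primitive]) auto
  then show "profile_primitive \<gamma> x \<le> profile_mass \<gamma>" by (simp add: profile_primitive_right)
qed

end

section \<open>Real analyticity of the primitive\<close>

text \<open>Integrating a power series termwise divides the coefficients by growing numbers, so the result
  converges wherever the series itself does absolutely, and it has the same derivative as \<open>f\<close>.\<close>

lemma has_fps_expansion_antiderivative:
  fixes f g :: "real \<Rightarrow> real"
  assumes g: "g has_fps_expansion G"
    and f: "\<forall>\<^sub>F h in nhds 0. (f has_real_derivative g h) (at h)"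
  shows "f has_fps_expansion fps_integral G (f 0)"
proof -
  let ?I = "fps_integral G (f 0)"
  have dI: "fps_deriv ?I = G" by (simp add: fps_deriv_fps_integral)
  have "0 < fps_conv_radius G" using g by (simp add: has_fps_expansion_def)
  then obtain r :: real where r: "0 < ereal r" "ereal r < fps_conv_radius G"
    using ereal_dense2 by blast
  then have "summable (\<lambda>n. norm (fps_nth G n * r ^ n))"
    by (intro abs_summable_in_conv_radius) (auto simp: fps_conv_radius_def)
  then have s: "summable (\<lambda>n. r * norm (fps_nth G n * r ^ n))" by (rule summable_mult)
  have "summable (\<lambda>n. fps_nth ?I (Suc n) * r ^ Suc n)"
  proof (rule summable_comparison_test'[OF s, of 0])
    fix n :: nat
    have "norm (fps_nth ?I (Suc n) * r ^ Suc n) = (r * norm (fps_nth G n * r ^ n)) / real (Suc n)"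
      using r by (simp add: abs_mult field_simps)
    also have "\<dots> \<le> (r * norm (fps_nth G n * r ^ n)) / 1" using r by (intro divide_left_mono) auto
    finally show "norm (fps_nth ?I (Suc n) * r ^ Suc n) \<le> r * norm (fps_nth G n * r ^ n)" by simp
  qed
  then have "summable (\<lambda>n. fps_nth ?I n * r ^ n)" by (rule summable_Suc_iff[THEN iffD1])
  then have "ereal (norm r) \<le> fps_conv_radius ?I" unfolding fps_conv_radius_def by (rule conv_radius_geI)
  then have rI: "ereal r \<le> fps_conv_radius ?I" using r by simp
  have "\<forall>\<^sub>F h in nhds 0. eval_fps G h = g h" using g by (simp add: has_fps_expansion_def)
  with f have "\<forall>\<^sub>F h in nhds 0. (f has_real_derivative eval_fps G h) (at h)" by eventually_elim simp
  then obtain d where d: "0 < d" "\<And>h. \<bar>h\<bar> < d \<Longrightarrow> (f has_real_derivative eval_fps G h) (at h)"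
    by (auto simp: eventually_nhds_metric dist_real_def)
  define e where "e = min d r"
  have e: "0 < e" using d r by (simp add: e_def)
  have "\<exists>c. \<forall>h\<in>ball 0 e. eval_fps ?I h - f h = c"
  proof (rule has_field_derivative_zero_constant)
    fix h :: real assume h: "h \<in> ball 0 e"
    then have "ereal (norm h) < ereal r" "\<bar>h\<bar> < d" by (auto simp: e_def)
    then have "((\<lambda>h. eval_fps ?I h - f h) has_real_derivative eval_fps (fps_deriv ?I) h - eval_fps G h) (at h)"
      by (intro DERIV_diff has_field_derivative_eval_fps d less_le_trans[OF _ rI]) auto
    then show "((\<lambda>h. eval_fps ?I h - f h) has_field_derivative 0) (at h within ball 0 e)"
      unfolding dI by (auto intro: has_field_derivative_at_within)
  qed auto
  then obtain c where c: "\<And>h. h \<in> ball 0 e \<Longrightarrow> eval_fps ?I h - f h = c" by blast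
  have "c = 0" using c[of 0] e by (simp add: eval_fps_at_0)
  have "\<forall>\<^sub>F h in nhds 0. h \<in> ball 0 e" using e by (intro eventually_nhds_in_open) auto
  then have "\<forall>\<^sub>F h in nhds 0. eval_fps ?I h = f h"
    by eventually_elim (use c \<open>c = 0\<close> in force)
  moreover have "0 < fps_conv_radius ?I" using r rI by order
  ultimately show ?thesis by (simp add: has_fps_expansion_def)
qed

lemma has_fps_expansion_affine_powr:
  fixes y c a :: real
  assumes "0 < y"
  shows "(\<lambda>h. (y + c * h) powr a) has_fps_expansion
           Abs_fps (\<lambda>n. (a gchoose n) * y powr (a - real n) * c ^ n)"
proof (rule has_fps_expansionI)
  have "isCont (\<lambda>h. \<bar>c * h\<bar>) 0" by (intro continuous_intros)
  then have "\<forall>\<^sub>F h in nhds 0. \<bar>c * h\<bar> < y"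
    unfolding isCont_def by (intro order_tendstoD(2)[of _ 0]) (use assms in \<open>auto simp: tendsto_nhds_iff\<close>)
  then show "\<forall>\<^sub>F h in nhds 0. (\<lambda>n. fps_nth (Abs_fps (\<lambda>n. (a gchoose n) * y powr (a - real n) * c ^ n)) n * h ^ n)
      sums ((y + c * h) powr a)"
  proof eventually_elim
    case (elim h)
    from gen_binomial_real''[OF elim, of a] show ?case
      by (simp add: power_mult_distrib mult_ac)
  qed
qed

text \<open>Inside the interval \<open>1 - t^2 = (1-t)(1+t)\<close> splits the profile into two powers of affine
  functions, each with a binomial series. The factor \<open>c\<close> admits a rescaled argument.\<close>

lemma profile_primitive_has_fps_expansion:
  assumes \<gamma>: "0 < \<gamma>" and x: "\<bar>x\<bar> < 1"
  shows "\<exists>F. (\<lambda>h. profile_primitive \<gamma> (x + c * h)) has_fps_expansion F"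
proof -
  let ?v = "\<lambda>h. ((1 - x) + (- c) * h) powr \<gamma> * ((1 + x) + c * h) powr \<gamma>"
  have "0 < 1 - x" "0 < 1 + x" using x by auto
  then have "\<exists>G. ?v has_fps_expansion G"
    using has_fps_expansion_mult[OF has_fps_expansion_affine_powr has_fps_expansion_affine_powr] by blast
  then obtain G where G: "(\<lambda>h. c * ?v h) has_fps_expansion fps_const c * G"
    using has_fps_expansion_cmult_left by blast
  have "isCont (\<lambda>h. \<bar>x + c * h\<bar>) 0" by (intro continuous_intros)
  then have "\<forall>\<^sub>F h in nhds 0. \<bar>x + c * h\<bar> < 1"
    unfolding isCont_def by (intro order_tendstoD(2)[of _ "\<bar>x\<bar>"]) (use x in \<open>auto simp: tendsto_nhds_iff\<close>)
  then have "\<forall>\<^sub>F h in nhds 0. ((\<lambda>h. profile_primitive \<gamma> (x + c * h)) has_real_derivative c * ?v h) (at h)"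
  proof eventually_elim
    case (elim h)
    have "profile \<gamma> (x + c * h) = ((1 - (x + c * h)) * (1 + (x + c * h))) powr \<gamma>"
      using elim by (simp add: profile_inside power2_eq_square algebra_simps)
    also have "\<dots> = ?v h" using elim by (subst powr_mult) (auto simp: algebra_simps)
    finally have "c * ?v h = profile \<gamma> (x + c * h) * c" by simp
    then show ?case
      by (simp only:) (rule DERIV_chain2[OF has_derivative_profile_primitive[OF \<gamma>]], auto intro!: derivative_eq_intros)
  qed
  from has_fps_expansion_antiderivative[OF G this] show ?thesis by blast
qed

section \<open>Moving the singularity by a disc automorphism\<close>

text \<open>The increment \<open>z = t - x\<close> for the image \<open>t = (x+s)/(1+xs)\<close> of \<open>s\<close> under the automorphism of \<open>(-1,1)\<close>
  that maps \<open>0\<close> to \<open>x\<close>.\<close>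

definition moebius_shift :: "real \<Rightarrow> real \<Rightarrow> real" where
  "moebius_shift x s = s * (1 - x\<^sup>2) / (1 + x * s)"

lemma one_plus_mult_pos: "\<bar>x\<bar> < 1 \<Longrightarrow> 0 \<le> s \<Longrightarrow> s \<le> 1 \<Longrightarrow> 0 < 1 + x * (s::real)"
proof -
  assume a: "\<bar>x\<bar> < 1" "0 \<le> s" "s \<le> 1"
  then have "\<bar>x * s\<bar> \<le> \<bar>x\<bar> * 1" unfolding abs_mult by (intro mult_mono) auto
  then show ?thesis using a by linarith
qed

lemma moebius_shift_mono:
  assumes "\<bar>x\<bar> < 1" "0 \<le> s" "s \<le> t" "t \<le> 1"
  shows "moebius_shift x s \<le> moebius_shift x t"
proof -
  have p: "0 < 1 + x * s" "0 < 1 + x * t" "0 \<le> 1 - x\<^sup>2"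
    using assms by (auto intro!: one_plus_mult_pos simp: abs_square_le_1)
  have "s * (1 - x\<^sup>2) * (1 + x * t) - t * (1 - x\<^sup>2) * (1 + x * s) = (1 - x\<^sup>2) * (s - t)"
    by (simp add: algebra_simps)
  also have "\<dots> \<le> 0" using p assms by (intro mult_nonneg_nonpos) auto
  finally show ?thesis
    unfolding moebius_shift_def using p by (subst frac_le_eq) (auto intro!: divide_nonpos_pos)
qed

lemma moebius_shift_one: "\<bar>x\<bar> < 1 \<Longrightarrow> moebius_shift x 1 = 1 - x"
  unfolding moebius_shift_def by (auto simp: field_simps power2_eq_square)

lemma moebius_shift_pos: "\<bar>x\<bar> < 1 \<Longrightarrow> 0 < s \<Longrightarrow> s \<le> 1 \<Longrightarrow> 0 < moebius_shift x s"
  unfolding moebius_shift_def using one_plus_mult_pos[of x s]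
  by (intro divide_pos_pos mult_pos_pos) (auto simp: abs_square_less_1)

lemma moebius_shift_has_derivative:
  assumes "\<bar>x\<bar> < 1" "0 \<le> s" "s \<le> 1"
  shows "(moebius_shift x has_real_derivative (1 - x\<^sup>2) / (1 + x * s)\<^sup>2) (at s within S)"
proof -
  have "1 + x * s \<noteq> 0" using one_plus_mult_pos[OF assms] by simp
  then show ?thesis unfolding moebius_shift_def[abs_def]
    by (auto intro!: derivative_eq_intros simp: field_simps power2_eq_square)
qed

context
  fixes \<gamma> :: real
  assumes \<gamma>: "0 < \<gamma>" "\<gamma> < 1"
begin

text \<open>With \<open>Q = 1 - x^2\<close> and \<open>D = 1 + xs\<close> one has \<open>z = sQ/D\<close> and \<open>1 - (x+z)^2 = Q(1-s^2)/D^2\<close>. The profile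
  contributes \<open>D^(-2\<gamma>)\<close> and the kernel \<open>D^(2\<gamma>)\<close>, and these cancel because the exponent of the profile is
  half of the order of the operator.\<close>

lemma moebius_integrand:
  assumes x: "\<bar>x\<bar> < 1" and s: "0 < s" "s \<le> 1"
  shows "(1 - x\<^sup>2) / (1 + x * s)\<^sup>2 *
      (profile \<gamma> (x + moebius_shift x s) * moebius_shift x s powr - (2 * \<gamma>))
    = (1 - x\<^sup>2) powr (1 - \<gamma>) * (s powr - (2 * \<gamma>) * profile \<gamma> s / (1 + x * s)\<^sup>2)"
proof -
  define Q where "Q = 1 - x\<^sup>2"
  define D where "D = 1 + x * s"
  have Q: "0 < Q" using x by (simp add: Q_def abs_square_less_1)
  have D: "0 < D" using one_plus_mult_pos[of x s] x s by (simp add: D_def)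
  have s1: "0 \<le> 1 - s\<^sup>2" using s by (simp add: power_le_one)
  have z: "moebius_shift x s = s * Q / D" by (simp add: moebius_shift_def Q_def D_def)
  have "x + moebius_shift x s = (x + s) / D"
    using D unfolding z by (simp add: D_def Q_def field_simps power2_eq_square)
  then have "1 - (x + moebius_shift x s)\<^sup>2 = (D\<^sup>2 - (x + s)\<^sup>2) / D\<^sup>2"
    using D by (simp add: power_divide diff_divide_distrib)
  also have "D\<^sup>2 - (x + s)\<^sup>2 = Q * (1 - s\<^sup>2)" by (simp add: D_def Q_def power2_eq_square algebra_simps)
  finally have e: "1 - (x + moebius_shift x s)\<^sup>2 = Q * (1 - s\<^sup>2) / D\<^sup>2" .
  then have "0 \<le> 1 - (x + moebius_shift x s)\<^sup>2" using Q s1 by simp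
  then have "profile \<gamma> (x + moebius_shift x s) = (Q * (1 - s\<^sup>2) / D\<^sup>2) powr \<gamma>"
    unfolding e[symmetric] by (simp add: profile_def)
  also have "\<dots> = Q powr \<gamma> * (1 - s\<^sup>2) powr \<gamma> / D powr (2 * \<gamma>)"
    using Q s1 D by (simp add: powr_divide powr_mult powr_powr flip: powr_numeral)
  also have "(1 - s\<^sup>2) powr \<gamma> = profile \<gamma> s" using s by (simp add: profile_inside)
  finally have u: "profile \<gamma> (x + moebius_shift x s) = Q powr \<gamma> * profile \<gamma> s / D powr (2 * \<gamma>)" .
  have zp: "moebius_shift x s powr - (2 * \<gamma>) = s powr - (2 * \<gamma>) * Q powr - (2 * \<gamma>) * D powr (2 * \<gamma>)"
    unfolding z using s Q D by (simp add: powr_divide powr_mult powr_minus field_simps)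
  have "Q powr (1 - \<gamma>) = Q powr 1 * Q powr \<gamma> * Q powr - (2 * \<gamma>)"
    unfolding powr_add[symmetric] by simp
  then have "Q powr (1 - \<gamma>) = Q * Q powr \<gamma> * Q powr - (2 * \<gamma>)" using Q by simp
  then show ?thesis unfolding u zp Q_def[symmetric] D_def[symmetric] using D by simp
qed

lemma continuous_on_profile_powr:
  assumes "0 < a"
  shows "continuous_on {a..b} (\<lambda>z. profile \<gamma> (x + z) * z powr e)"
  using assms \<gamma> by (intro continuous_intros continuous_on_compose2[OF continuous_on_profile[of \<gamma> UNIV]]) auto

text \<open>The substitution ends at \<open>s = 1\<close>, that is \<open>z = 1 - x < 2 \<le> N\<close>, beyond which the profile vanishes.\<close>

lemma truncated_convolution_moebius:
  assumes x: "\<bar>x\<bar> < 1" and s: "0 < s" "s \<le> 1" and N: "2 \<le> N"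
  shows "integral {moebius_shift x s..N} (\<lambda>z. profile \<gamma> (x + z) * z powr - (2 * \<gamma>))
    = (1 - x\<^sup>2) powr (1 - \<gamma>) * integral {s..1} (\<lambda>\<sigma>. \<sigma> powr - (2 * \<gamma>) * profile \<gamma> \<sigma> / (1 + x * \<sigma>)\<^sup>2)"
proof -
  let ?f = "\<lambda>z. profile \<gamma> (x + z) * z powr - (2 * \<gamma>)"
  let ?g = "\<lambda>\<sigma>. \<sigma> powr - (2 * \<gamma>) * profile \<gamma> \<sigma> / (1 + x * \<sigma>)\<^sup>2"
  have pos: "0 < moebius_shift x s" by (rule moebius_shift_pos[OF x s])
  have le: "moebius_shift x s \<le> 1 - x" using moebius_shift_mono[of x s 1] moebius_shift_one[of x] x s by simp
  have int: "?f integrable_on {a..b}" if "0 < a" for a b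
    by (rule integrable_continuous_interval) (rule continuous_on_profile_powr[OF that])
  have "integral {1 - x..N} ?f = 0"
    by (rule integral_unique, rule has_integral_eq[of _ "\<lambda>_. 0"]) (auto simp: profile_outside)
  moreover have "integral {moebius_shift x s..1 - x} ?f + integral {1 - x..N} ?f = integral {moebius_shift x s..N} ?f"
    using le N x pos by (intro Henstock_Kurzweil_Integration.integral_combine int) auto
  ultimately have "integral {moebius_shift x s..N} ?f = integral {moebius_shift x s..moebius_shift x 1} ?f"
    using moebius_shift_one[OF x] by simp
  also have "\<dots> = integral {s..1} (\<lambda>\<sigma>. ((1 - x\<^sup>2) / (1 + x * \<sigma>)\<^sup>2) *\<^sub>R ?f (moebius_shift x \<sigma>))"
  proof (rule integral_unique[symmetric],
      rule has_integral_substitution[where f = ?f and g = "moebius_shift x" and a = s and b = 1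
        and g' = "\<lambda>\<sigma>. (1 - x\<^sup>2) / (1 + x * \<sigma>)\<^sup>2" and c = "moebius_shift x s" and d = "1 - x"])
    show "moebius_shift x ` {s..1} \<subseteq> {moebius_shift x s..1 - x}"
      using x s moebius_shift_mono[of x s] moebius_shift_mono[of x _ 1] moebius_shift_one[of x] by force
    show "continuous_on {moebius_shift x s..1 - x} ?f" by (rule continuous_on_profile_powr[OF pos])
    show "(moebius_shift x has_real_derivative (1 - x\<^sup>2) / (1 + x * \<sigma>)\<^sup>2) (at \<sigma> within {s..1})"
      if "\<sigma> \<in> {s..1}" for \<sigma>
      using that s by (intro moebius_shift_has_derivative x) auto
  qed (use s x le moebius_shift_one[of x] in auto)
  also have "\<dots> = integral {s..1} (\<lambda>\<sigma>. (1 - x\<^sup>2) powr (1 - \<gamma>) * ?g \<sigma>)"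
    by (rule Henstock_Kurzweil_Integration.integral_cong)
       (use s in \<open>simp only: real_scaleR_def, intro moebius_integrand x, auto\<close>)
  finally show ?thesis by (simp only: Henstock_Kurzweil_Integration.integral_mult_right)
qed

end

text \<open>In terms of squares this is the Moebius map \<open>v = r/(1 - q + qr)\<close> of \<open>[0,1]\<close> with \<open>q = x^2\<close>, which is the
  substitution behind the identity \<open>F(a,b;b;q) = (1-q)^(-a)\<close> for the hypergeometric function.\<close>

definition disc_rescale :: "real \<Rightarrow> real \<Rightarrow> real" where
  "disc_rescale x \<rho> = \<rho> / (1 - x\<^sup>2 + x\<^sup>2 * \<rho>\<^sup>2) powr (1 / 2)"

lemma disc_rescale_one: "disc_rescale x 1 = 1"
  by (simp add: disc_rescale_def)

lemma disc_rescale_denominator_pos: "\<bar>x::real\<bar> < 1 \<Longrightarrow> 0 < 1 - x\<^sup>2 + x\<^sup>2 * \<rho>\<^sup>2"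
  by (rule add_pos_nonneg) (auto simp: abs_square_less_1)

lemma disc_rescale_pos: "\<bar>x\<bar> < 1 \<Longrightarrow> 0 < \<rho> \<Longrightarrow> 0 < disc_rescale x \<rho>"
  unfolding disc_rescale_def using disc_rescale_denominator_pos[of x \<rho>] by auto

lemma disc_rescale_has_derivative:
  assumes x: "\<bar>x\<bar> < 1"
  shows "(disc_rescale x has_real_derivative
            (1 - x\<^sup>2) * (1 - x\<^sup>2 + x\<^sup>2 * \<rho>\<^sup>2) powr (- 3 / 2)) (at \<rho> within S)"
proof -
  define E where "E = (\<lambda>\<rho>. 1 - x\<^sup>2 + x\<^sup>2 * \<rho>\<^sup>2)"
  have E: "0 < E \<rho>" for \<rho> using disc_rescale_denominator_pos[OF x] by (simp add: E_def)
  have dE: "(E has_real_derivative 2 * x\<^sup>2 * \<rho>) (at \<rho>)"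
    unfolding E_def by (auto intro!: derivative_eq_intros)
  have "disc_rescale x = (\<lambda>\<rho>. \<rho> * E \<rho> powr (- 1 / 2))"
    unfolding disc_rescale_def E_def using powr_minus_divide[of _ "1 / 2 :: real"] by (simp add: fun_eq_iff)
  moreover have "((\<lambda>\<rho>. \<rho> * E \<rho> powr (- 1 / 2)) has_real_derivative
      1 * E \<rho> powr (- 1 / 2) + (- 1 / 2 * E \<rho> powr (- 1 / 2 - of_nat 1) * (2 * x\<^sup>2 * \<rho>)) * \<rho>) (at \<rho>)"
    by (rule DERIV_mult[OF DERIV_ident DERIV_fun_powr[OF dE E]])
  ultimately have deriv: "(disc_rescale x has_real_derivative
      E \<rho> powr (- 1 / 2) - x\<^sup>2 * \<rho>\<^sup>2 * E \<rho> powr (- 3 / 2)) (at \<rho>)"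
    by (simp add: power2_eq_square mult_ac)
  have "E \<rho> powr (- 1 / 2) = E \<rho> * E \<rho> powr (- 3 / 2)"
    using powr_add[of "E \<rho>" 1 "- 3 / 2"] E[of \<rho>] by simp
  then have "E \<rho> powr (- 1 / 2) - x\<^sup>2 * \<rho>\<^sup>2 * E \<rho> powr (- 3 / 2) = (E \<rho> - x\<^sup>2 * \<rho>\<^sup>2) * E \<rho> powr (- 3 / 2)"
    by (simp only: left_diff_distrib)
  moreover have "E \<rho> - x\<^sup>2 * \<rho>\<^sup>2 = 1 - x\<^sup>2" by (simp add: E_def)
  ultimately have "(disc_rescale x has_real_derivative (1 - x\<^sup>2) * E \<rho> powr (- 3 / 2)) (at \<rho>)"
    using deriv by (simp only:)
  then have "(disc_rescale x has_real_derivative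
            (1 - x\<^sup>2) * (1 - x\<^sup>2 + x\<^sup>2 * \<rho>\<^sup>2) powr (- 3 / 2)) (at \<rho>)"
    by (simp only: E_def)
  then show ?thesis by (rule has_field_derivative_at_within)
qed

lemma disc_rescale_mono:
  assumes x: "\<bar>x\<bar> < 1" and "\<rho> \<le> \<rho>'"
  shows "disc_rescale x \<rho> \<le> disc_rescale x \<rho>'"
proof (rule DERIV_nonneg_imp_nondecreasing[OF \<open>\<rho> \<le> \<rho>'\<close>])
  fix t
  show "\<exists>y. (disc_rescale x has_real_derivative y) (at t) \<and> 0 \<le> y"
    using disc_rescale_has_derivative[OF x, of t UNIV]
  proof (intro exI conjI)
    show "0 \<le> (1 - x\<^sup>2) * (1 - x\<^sup>2 + x\<^sup>2 * t\<^sup>2) powr (- 3 / 2)"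
      using x by (intro mult_nonneg_nonneg) (auto simp: abs_square_le_1)
  qed
qed

context
  fixes \<gamma> :: real
  assumes \<gamma>: "0 < \<gamma>" "\<gamma> < 1"
begin

text \<open>With \<open>E = Q + x^2 \<rho>^2\<close> one has \<open>1 - s^2 = Q(1-\<rho>^2)/E\<close> and \<open>1 - x^2 s^2 = Q/E\<close>. The powers of \<open>E\<close> have
  exponents \<open>-3/2\<close>, \<open>\<gamma> - 1/2\<close>, \<open>-\<gamma>\<close> and \<open>2\<close>, of sum zero.\<close>

lemma disc_rescale_integrand:
  assumes x: "\<bar>x\<bar> < 1" and r: "0 < \<rho>" "\<rho> \<le> 1"
  shows "(1 - x\<^sup>2) * (1 - x\<^sup>2 + x\<^sup>2 * \<rho>\<^sup>2) powr (- 3 / 2) *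
      (disc_rescale x \<rho> powr (1 - 2 * \<gamma>) * profile \<gamma> (disc_rescale x \<rho>) / (1 - x\<^sup>2 * (disc_rescale x \<rho>)\<^sup>2)\<^sup>2)
    = (1 - x\<^sup>2) powr (\<gamma> - 1) * (\<rho> powr (1 - 2 * \<gamma>) * profile \<gamma> \<rho>)"
proof -
  define Q where "Q = 1 - x\<^sup>2"
  define E where "E = Q + x\<^sup>2 * \<rho>\<^sup>2"
  define s where "s = disc_rescale x \<rho>"
  have Q: "0 < Q" using x by (simp add: Q_def abs_square_less_1)
  have E: "0 < E" using disc_rescale_denominator_pos[OF x, of \<rho>] by (simp add: E_def Q_def)
  have s: "s = \<rho> / E powr (1 / 2)" by (simp add: s_def disc_rescale_def E_def Q_def)
  have r1: "0 \<le> 1 - \<rho>\<^sup>2" using r by (simp add: power_le_one)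
  have s2: "s\<^sup>2 = \<rho>\<^sup>2 / E"
    unfolding s using E by (simp add: power_divide powr_powr flip: powr_numeral)
  have "1 - s\<^sup>2 = (E - \<rho>\<^sup>2) / E" unfolding s2 using E by (simp add: diff_divide_distrib)
  also have "E - \<rho>\<^sup>2 = Q * (1 - \<rho>\<^sup>2)" by (simp add: E_def Q_def algebra_simps)
  finally have e: "1 - s\<^sup>2 = Q * (1 - \<rho>\<^sup>2) / E" .
  then have "0 \<le> 1 - s\<^sup>2" using Q E r1 by simp
  then have "profile \<gamma> s = (Q * (1 - \<rho>\<^sup>2) / E) powr \<gamma>"
    unfolding e[symmetric] by (simp add: profile_def)
  also have "\<dots> = Q powr \<gamma> * (1 - \<rho>\<^sup>2) powr \<gamma> * E powr - \<gamma>"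
    using Q r1 E by (simp add: powr_divide powr_mult powr_minus_divide)
  also have "(1 - \<rho>\<^sup>2) powr \<gamma> = profile \<gamma> \<rho>" using r by (simp add: profile_inside)
  finally have u: "profile \<gamma> s = Q powr \<gamma> * profile \<gamma> \<rho> * E powr - \<gamma>" .
  have "1 - x\<^sup>2 * s\<^sup>2 = (E - x\<^sup>2 * \<rho>\<^sup>2) / E" unfolding s2 using E by (simp add: diff_divide_distrib)
  then have "1 - x\<^sup>2 * s\<^sup>2 = Q / E" by (simp add: E_def)
  then have "1 / (1 - x\<^sup>2 * s\<^sup>2)\<^sup>2 = 1 / (Q / E)\<^sup>2" by (simp only:)
  then have d: "1 / (1 - x\<^sup>2 * s\<^sup>2)\<^sup>2 = E powr 2 * Q powr - 2"
    using Q E by (simp add: power_divide powr_minus_divide)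
  have sp: "s powr (1 - 2 * \<gamma>) = \<rho> powr (1 - 2 * \<gamma>) * E powr (- (1 / 2) + \<gamma>)"
  proof -
    have "s powr (1 - 2 * \<gamma>) = \<rho> powr (1 - 2 * \<gamma>) / E powr (1 / 2 * (1 - 2 * \<gamma>))"
      unfolding s using r E by (simp add: powr_divide powr_powr)
    also have "\<dots> = \<rho> powr (1 - 2 * \<gamma>) * E powr - (1 / 2 * (1 - 2 * \<gamma>))"
      by (simp only: powr_minus divide_inverse)
    also have "- (1 / 2 * (1 - 2 * \<gamma>)) = - (1 / 2) + \<gamma>" by (simp add: diff_divide_distrib)
    finally show ?thesis .
  qed
  have "E powr (- 3 / 2) * E powr (- (1 / 2) + \<gamma>) * E powr - \<gamma> * E powr 2 = E powr 0"
    unfolding powr_add[symmetric] by simp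
  then have Ep: "E powr (- 3 / 2) * E powr (- (1 / 2) + \<gamma>) * E powr - \<gamma> * E powr 2 = 1" using E by simp
  have "Q powr 1 * Q powr \<gamma> * Q powr - 2 = Q powr (\<gamma> - 1)"
    unfolding powr_add[symmetric] by simp
  then have Qp: "Q * Q powr \<gamma> * Q powr - 2 = Q powr (\<gamma> - 1)" using Q by simp
  have "Q * E powr (- 3 / 2) * (s powr (1 - 2 * \<gamma>) * profile \<gamma> s * (1 / (1 - x\<^sup>2 * s\<^sup>2)\<^sup>2))
     = (Q * Q powr \<gamma> * Q powr - 2) * (E powr (- 3 / 2) * E powr (- (1 / 2) + \<gamma>) * E powr - \<gamma> * E powr 2)
        * (\<rho> powr (1 - 2 * \<gamma>) * profile \<gamma> \<rho>)"
    unfolding u sp d by (simp only: mult_ac)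
  then show ?thesis unfolding Ep Qp s_def by (simp add: Q_def E_def)
qed

lemma disc_rescale_integral:
  assumes x: "\<bar>x\<bar> < 1" and t: "0 < \<tau>" "\<tau> \<le> 1"
  shows "integral {disc_rescale x \<tau>..1} (\<lambda>s. s powr (1 - 2 * \<gamma>) * profile \<gamma> s / (1 - x\<^sup>2 * s\<^sup>2)\<^sup>2)
    = (1 - x\<^sup>2) powr (\<gamma> - 1) * integral {\<tau>..1} (\<lambda>\<rho>. \<rho> powr (1 - 2 * \<gamma>) * profile \<gamma> \<rho>)"
proof -
  let ?f = "\<lambda>s. s powr (1 - 2 * \<gamma>) * profile \<gamma> s / (1 - x\<^sup>2 * s\<^sup>2)\<^sup>2"
  have pos: "0 < disc_rescale x \<tau>" by (rule disc_rescale_pos[OF x t(1)])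
  have le: "disc_rescale x \<tau> \<le> 1" using disc_rescale_mono[OF x t(2)] by (simp add: disc_rescale_one)
  have nz: "1 - x\<^sup>2 * s\<^sup>2 \<noteq> 0" if "0 \<le> s" "s \<le> 1" for s
  proof -
    have "x\<^sup>2 * s\<^sup>2 \<le> x\<^sup>2 * 1" using that by (intro mult_left_mono) (auto simp: power_le_one)
    also have "\<dots> < 1" using x by (simp add: abs_square_less_1)
    finally show ?thesis by simp
  qed
  have "integral {disc_rescale x \<tau>..disc_rescale x 1} ?f
      = integral {\<tau>..1} (\<lambda>\<rho>. ((1 - x\<^sup>2) * (1 - x\<^sup>2 + x\<^sup>2 * \<rho>\<^sup>2) powr (- 3 / 2)) *\<^sub>R ?f (disc_rescale x \<rho>))"
  proof (rule integral_unique[symmetric],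
      rule has_integral_substitution[where f = ?f and g = "disc_rescale x" and a = \<tau> and b = 1
        and g' = "\<lambda>\<rho>. (1 - x\<^sup>2) * (1 - x\<^sup>2 + x\<^sup>2 * \<rho>\<^sup>2) powr (- 3 / 2)" and c = "disc_rescale x \<tau>" and d = 1])
    show "disc_rescale x ` {\<tau>..1} \<subseteq> {disc_rescale x \<tau>..1}"
      using disc_rescale_mono[OF x, of \<tau>] disc_rescale_mono[OF x, of _ 1] by (auto simp: disc_rescale_one)
    show "continuous_on {disc_rescale x \<tau>..1} ?f"
      using pos \<gamma> nz by (intro continuous_intros) auto
    show "(disc_rescale x has_real_derivative (1 - x\<^sup>2) * (1 - x\<^sup>2 + x\<^sup>2 * \<rho>\<^sup>2) powr (- 3 / 2)) (at \<rho> within {\<tau>..1})" for \<rho>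
      by (rule disc_rescale_has_derivative[OF x])
  qed (use t le in \<open>auto simp: disc_rescale_one\<close>)
  also have "\<dots> = integral {\<tau>..1} (\<lambda>\<rho>. (1 - x\<^sup>2) powr (\<gamma> - 1) * (\<rho> powr (1 - 2 * \<gamma>) * profile \<gamma> \<rho>))"
    by (rule Henstock_Kurzweil_Integration.integral_cong)
       (use t in \<open>simp only: real_scaleR_def, intro disc_rescale_integrand x, auto\<close>)
  finally show ?thesis by (simp add: disc_rescale_one)
qed

text \<open>The two one-sided integrals are transformed with the automorphisms for \<open>x\<close> and \<open>-x\<close>, so that they live
  on the same interval and their integrands can be subtracted; this is where the factor \<open>x\<close> appears.
  The cutoffs are chosen so that they become the common point \<open>\<tau>\<close> after both substitutions.\<close>

lemma truncated_odd_convolution: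
  assumes x: "\<bar>x\<bar> < 1" and t: "0 < \<tau>" "\<tau> \<le> 1" and N: "2 \<le> N"
  defines "s \<equiv> disc_rescale x \<tau>"
  shows "integral {moebius_shift x s..N} (\<lambda>z. profile \<gamma> (x + z) * z powr - (2 * \<gamma>))
       - integral {moebius_shift (- x) s..N} (\<lambda>z. profile \<gamma> (x - z) * z powr - (2 * \<gamma>))
     = - 4 * x * integral {\<tau>..1} (\<lambda>\<rho>. \<rho> powr (1 - 2 * \<gamma>) * profile \<gamma> \<rho>)"
proof -
  have s: "0 < s" "s \<le> 1"
    using disc_rescale_pos[OF x t(1)] disc_rescale_mono[OF x t(2)] by (auto simp: s_def disc_rescale_one)
  have x': "\<bar>- x\<bar> < 1" using x by simp
  define Q where "Q = 1 - x\<^sup>2"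
  have Q: "0 < Q" using x by (simp add: Q_def abs_square_less_1)
  let ?g = "\<lambda>x \<sigma>. \<sigma> powr - (2 * \<gamma>) * profile \<gamma> \<sigma> / (1 + x * \<sigma>)\<^sup>2"
  let ?h = "\<lambda>\<sigma>. \<sigma> powr (1 - 2 * \<gamma>) * profile \<gamma> \<sigma> / (1 - x\<^sup>2 * \<sigma>\<^sup>2)\<^sup>2"
  have gi: "?g y integrable_on {s..1}" if y: "\<bar>y\<bar> < 1" for y
  proof (rule integrable_continuous_interval, intro continuous_intros \<gamma>)
    have "0 < 1 + y * \<sigma>" if "\<sigma> \<in> {s..1}" for \<sigma>
      using that s by (intro one_plus_mult_pos[OF y]) auto
    then show "\<forall>\<sigma>\<in>{s..1}. (1 + y * \<sigma>)\<^sup>2 \<noteq> 0" by force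
  qed (use s in auto)
  have eq: "?g x \<sigma> - ?g (- x) \<sigma> = - 4 * x * ?h \<sigma>" if \<sigma>: "\<sigma> \<in> {s..1}" for \<sigma>
  proof -
    have p: "0 < 1 + x * \<sigma>" "0 < 1 + - x * \<sigma>"
      using one_plus_mult_pos[OF x, of \<sigma>] one_plus_mult_pos[OF x', of \<sigma>] \<sigma> s by auto
    have m: "(1 + x * \<sigma>) * (1 + - x * \<sigma>) = 1 - x\<^sup>2 * \<sigma>\<^sup>2" by (simp add: power2_eq_square algebra_simps)
    have "1 / (1 + x * \<sigma>)\<^sup>2 - 1 / (1 + - x * \<sigma>)\<^sup>2
        = ((1 + - x * \<sigma>)\<^sup>2 - (1 + x * \<sigma>)\<^sup>2) / ((1 + x * \<sigma>) * (1 + - x * \<sigma>))\<^sup>2"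
      using p by (simp add: diff_frac_eq power_mult_distrib)
    also have "(1 + - x * \<sigma>)\<^sup>2 - (1 + x * \<sigma>)\<^sup>2 = - 4 * x * \<sigma>" by (simp add: power2_eq_square algebra_simps)
    finally have k: "1 / (1 + x * \<sigma>)\<^sup>2 - 1 / (1 + - x * \<sigma>)\<^sup>2 = - 4 * x * \<sigma> / (1 - x\<^sup>2 * \<sigma>\<^sup>2)\<^sup>2"
      unfolding m .
    have "\<sigma> powr (1 - 2 * \<gamma>) = \<sigma> * \<sigma> powr - (2 * \<gamma>)"
      using powr_add[of \<sigma> 1 "- (2 * \<gamma>)"] \<sigma> s by simp
    then have "- 4 * x * ?h \<sigma> = (\<sigma> powr - (2 * \<gamma>) * profile \<gamma> \<sigma>) * (- 4 * x * \<sigma> / (1 - x\<^sup>2 * \<sigma>\<^sup>2)\<^sup>2)"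
      by simp
    also have "\<dots> = (\<sigma> powr - (2 * \<gamma>) * profile \<gamma> \<sigma>) * (1 / (1 + x * \<sigma>)\<^sup>2 - 1 / (1 + - x * \<sigma>)\<^sup>2)"
      by (simp only: k)
    finally show ?thesis by (simp only: right_diff_distrib times_divide_eq_right mult_1_right)
  qed
  have "(\<lambda>z. profile \<gamma> (x - z) * z powr - (2 * \<gamma>)) = (\<lambda>z. profile \<gamma> (- x + z) * z powr - (2 * \<gamma>))"
    using profile_minus[of \<gamma> "x - z" for z] by (simp add: fun_eq_iff)
  then have "integral {moebius_shift x s..N} (\<lambda>z. profile \<gamma> (x + z) * z powr - (2 * \<gamma>))
       - integral {moebius_shift (- x) s..N} (\<lambda>z. profile \<gamma> (x - z) * z powr - (2 * \<gamma>))
    = Q powr (1 - \<gamma>) * (integral {s..1} (?g x) - integral {s..1} (?g (- x)))"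
    using truncated_convolution_moebius[OF \<gamma> x s N] truncated_convolution_moebius[OF \<gamma> x' s N]
    by (simp only: Q_def power2_minus right_diff_distrib)
  also have "integral {s..1} (?g x) - integral {s..1} (?g (- x)) = integral {s..1} (\<lambda>\<sigma>. ?g x \<sigma> - ?g (- x) \<sigma>)"
    by (rule Henstock_Kurzweil_Integration.integral_diff[symmetric]) (rule gi x x')+
  also have "\<dots> = integral {s..1} (\<lambda>\<sigma>. - 4 * x * ?h \<sigma>)"
    by (rule Henstock_Kurzweil_Integration.integral_cong) (rule eq)
  also have "\<dots> = - 4 * x * integral {s..1} ?h" by (rule integral_mult_right)
  also have "integral {s..1} ?h = Q powr (\<gamma> - 1) * integral {\<tau>..1} (\<lambda>\<rho>. \<rho> powr (1 - 2 * \<gamma>) * profile \<gamma> \<rho>)"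
    unfolding s_def Q_def by (rule disc_rescale_integral[OF x t])
  also have "Q powr (1 - \<gamma>) * (- 4 * x * (Q powr (\<gamma> - 1) * integral {\<tau>..1} (\<lambda>\<rho>. \<rho> powr (1 - 2 * \<gamma>) * profile \<gamma> \<rho>)))
     = (Q powr (1 - \<gamma>) * Q powr (\<gamma> - 1)) * (- 4 * x * integral {\<tau>..1} (\<lambda>\<rho>. \<rho> powr (1 - 2 * \<gamma>) * profile \<gamma> \<rho>))"
    by (simp only: mult_ac)
  also have "Q powr (1 - \<gamma>) * Q powr (\<gamma> - 1) = 1" using Q by (simp flip: powr_add)
  finally show ?thesis by simp
qed

end

section \<open>The Levy integral of the primitive\<close>

lemma moebius_shift_le:
  assumes "\<bar>x\<bar> < 1" "0 \<le> s" "s \<le> 1"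
  shows "moebius_shift x s \<le> 2 * s"
proof -
  have "(1 - x\<^sup>2) \<le> 2 * (1 + x * s)"
  proof -
    have "\<bar>x * s\<bar> \<le> \<bar>x\<bar> * 1" unfolding abs_mult using assms by (intro mult_mono) auto
    then have ge: "1 - \<bar>x\<bar> \<le> 1 + x * s" by linarith
    have "1 - x\<^sup>2 = (1 + \<bar>x\<bar>) * (1 - \<bar>x\<bar>)" by (simp add: power2_eq_square algebra_simps)
    also have "\<dots> \<le> 2 * (1 + x * s)" using assms ge by (intro mult_mono) auto
    finally show ?thesis .
  qed
  then have "s * (1 - x\<^sup>2) \<le> s * (2 * (1 + x * s))" using assms by (intro mult_left_mono) auto
  then show ?thesis unfolding moebius_shift_def using one_plus_mult_pos[OF assms]
    by (simp add: pos_divide_le_eq mult_ac)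
qed

lemma moebius_shift_ge:
  assumes "\<bar>x\<bar> < 1" "0 \<le> s" "s \<le> 1"
  shows "s * (1 - x\<^sup>2) / 2 \<le> moebius_shift x s"
proof -
  have "\<bar>x * s\<bar> \<le> 1 * 1" unfolding abs_mult using assms by (intro mult_mono) auto
  then have "1 + x * s \<le> 2" by linarith
  then show ?thesis
    unfolding moebius_shift_def using one_plus_mult_pos[OF assms] assms
    by (intro divide_left_mono) (auto simp: abs_square_le_1)
qed

text \<open>The cutoffs of the two sides agree to first order in \<open>s\<close>.\<close>

lemma moebius_shift_asymmetry:
  assumes "\<bar>x\<bar> < 1" "0 \<le> s" "s \<le> 1"
  shows "moebius_shift (- x) s - moebius_shift x s = 2 * x * s\<^sup>2 * (1 - x\<^sup>2) / (1 - x\<^sup>2 * s\<^sup>2)"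
    and "0 \<le> x \<Longrightarrow> moebius_shift (- x) s - moebius_shift x s \<le> 2 * s\<^sup>2"
    and "0 \<le> x \<Longrightarrow> moebius_shift x s \<le> moebius_shift (- x) s"
proof -
  have p: "0 < 1 + x * s" "0 < 1 - x * s"
    using one_plus_mult_pos[OF assms] one_plus_mult_pos[of "- x" s] assms by auto
  have m: "(1 + x * s) * (1 - x * s) = 1 - x\<^sup>2 * s\<^sup>2" by (simp add: power2_eq_square algebra_simps)
  have Q: "0 \<le> 1 - x\<^sup>2" using assms by (simp add: abs_square_le_1)
  have d: "0 < 1 - x\<^sup>2 * s\<^sup>2" using p unfolding m[symmetric] by simp
  have "moebius_shift (- x) s - moebius_shift x s
      = (s * (1 - x\<^sup>2) * (1 + x * s) - s * (1 - x\<^sup>2) * (1 - x * s)) / ((1 - x * s) * (1 + x * s))"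
    unfolding moebius_shift_def using p by (simp add: diff_frac_eq)
  also have "\<dots> = 2 * x * s\<^sup>2 * (1 - x\<^sup>2) / (1 - x\<^sup>2 * s\<^sup>2)"
    unfolding m[symmetric] by (rule arg_cong2[where f = "(/)"]) (simp_all add: power2_eq_square algebra_simps)
  finally show e: "moebius_shift (- x) s - moebius_shift x s = 2 * x * s\<^sup>2 * (1 - x\<^sup>2) / (1 - x\<^sup>2 * s\<^sup>2)" .
  assume x: "0 \<le> x"
  have "x\<^sup>2 * s\<^sup>2 \<le> x\<^sup>2 * 1" using assms by (intro mult_left_mono) (auto simp: power_le_one)
  then have "(1 - x\<^sup>2) / (1 - x\<^sup>2 * s\<^sup>2) \<le> 1" using d by simp
  then have "2 * x * s\<^sup>2 * ((1 - x\<^sup>2) / (1 - x\<^sup>2 * s\<^sup>2)) \<le> 2 * 1 * s\<^sup>2 * 1"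
    using assms Q d x by (intro mult_mono) auto
  then show "moebius_shift (- x) s - moebius_shift x s \<le> 2 * s\<^sup>2" unfolding e by simp
  have "0 \<le> 2 * x * s\<^sup>2 * (1 - x\<^sup>2) / (1 - x\<^sup>2 * s\<^sup>2)" using Q d x by (intro divide_nonneg_nonneg mult_nonneg_nonneg) auto
  then show "moebius_shift x s \<le> moebius_shift (- x) s" using e by linarith
qed

text \<open>Half of the Beta value \<open>B(1-\<gamma>, 1+\<gamma>)\<close>.\<close>

definition getoor_const :: "real \<Rightarrow> real" where
  "getoor_const \<gamma> = integral {0..1} (\<lambda>\<rho>. \<rho> powr (1 - 2 * \<gamma>) * profile \<gamma> \<rho>)"

context
  fixes \<gamma> :: real
  assumes \<gamma>: "0 < \<gamma>" "\<gamma> < 1"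
begin

text \<open>The exponent \<open>1 - 2\<gamma>\<close> exceeds \<open>-1\<close> because \<open>\<gamma> < 1\<close>.\<close>

lemma getoor_integrand_integrable: "(\<lambda>\<rho>. \<rho> powr (1 - 2 * \<gamma>) * profile \<gamma> \<rho>) integrable_on {0..1}"
proof (rule measurable_bounded_by_integrable_imp_integrable)
  show "(\<lambda>\<rho>. \<rho> powr (1 - 2 * \<gamma>)) integrable_on {0..1}"
    by (rule integrable_on_powr_from_0) (use \<gamma> in auto)
  have [measurable]: "profile \<gamma> \<in> borel_measurable borel"
    by (intro borel_measurable_continuous_onI continuous_on_profile \<gamma>)
  have "(\<lambda>\<rho>. \<rho> powr (1 - 2 * \<gamma>) * profile \<gamma> \<rho>) \<in> borel_measurable borel" by measurable
  then show "(\<lambda>\<rho>. \<rho> powr (1 - 2 * \<gamma>) * profile \<gamma> \<rho>) \<in> borel_measurable (lebesgue_on {0..1})"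
    by (intro measurable_restrict_space1 measurable_completion) simp
  fix \<rho> :: real
  show "norm (\<rho> powr (1 - 2 * \<gamma>) * profile \<gamma> \<rho>) \<le> \<rho> powr (1 - 2 * \<gamma>)"
    using profile_le_one[of \<gamma> \<rho>] profile_nonneg[of \<gamma> \<rho>] \<gamma> by (simp add: abs_mult mult_left_le)
qed simp

lemma getoor_const_truncated:
  assumes "0 \<le> \<tau>" "\<tau> \<le> 1"
  shows "integral {\<tau>..1} (\<lambda>\<rho>. \<rho> powr (1 - 2 * \<gamma>) * profile \<gamma> \<rho>)
       = getoor_const \<gamma> - integral {0..\<tau>} (\<lambda>\<rho>. \<rho> powr (1 - 2 * \<gamma>) * profile \<gamma> \<rho>)"
  using Henstock_Kurzweil_Integration.integral_combine[OF assms getoor_integrand_integrable]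
  by (simp add: getoor_const_def)

lemma getoor_const_pos: "0 < getoor_const \<gamma>"
proof -
  let ?g = "\<lambda>\<rho>. \<rho> powr (1 - 2 * \<gamma>) * profile \<gamma> \<rho>"
  have sub: "?g integrable_on {a..b}" if "{a..b} \<subseteq> {0..1}" for a b
    using integrable_subinterval_real[OF getoor_integrand_integrable that] .
  \<comment> \<open>The interval avoids the singularity of the power at 0, so that the integrand is continuous on it.\<close>
  have "integral {1/2..3/4::real} (\<lambda>_. 0) < integral {1/2..3/4} ?g"
  proof (rule integral_less_real)
    show "\<And>x. x \<in> {1/2<..<3/4} \<Longrightarrow> 0 < ?g x" using profile_pos[of _ \<gamma>] by auto
  qed (use sub in \<open>auto intro!: continuous_intros \<gamma>\<close>)
  also have "\<dots> \<le> getoor_const \<gamma>" unfolding getoor_const_def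
    by (intro integral_subset_le sub getoor_integrand_integrable) (auto simp: profile_nonneg)
  finally show ?thesis by simp
qed

lemma getoor_const_limit:
  assumes \<tau>: "\<tau> \<longlonglongrightarrow> 0" "\<And>n. 0 < \<tau> n" "\<And>n. \<tau> n \<le> 1"
  shows "(\<lambda>n. integral {\<tau> n..1} (\<lambda>\<rho>. \<rho> powr (1 - 2 * \<gamma>) * profile \<gamma> \<rho>)) \<longlonglongrightarrow> getoor_const \<gamma>"
proof -
  let ?g = "\<lambda>\<rho>. \<rho> powr (1 - 2 * \<gamma>) * profile \<gamma> \<rho>"
  have "continuous_on {0..1} (\<lambda>t. integral {0..t} ?g)"
    by (rule indefinite_integral_continuous_1[OF getoor_integrand_integrable])
  then have "(\<lambda>n. integral {0..\<tau> n} ?g) \<longlonglongrightarrow> integral {0..0} ?g"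
    by (rule continuous_on_tendsto_compose[OF _ \<tau>(1)])
       (use \<tau> less_imp_le in \<open>auto intro!: always_eventually\<close>)
  then have "(\<lambda>n. getoor_const \<gamma> - integral {0..\<tau> n} ?g) \<longlonglongrightarrow> getoor_const \<gamma> - 0"
    by (intro tendsto_intros) simp
  then show ?thesis using \<tau> by (simp add: getoor_const_truncated less_imp_le)
qed

text \<open>Antidifferentiating the kernel \<open>z^(-1-2\<gamma>)\<close> moves one derivative from the second difference to the
  profile.\<close>

lemma second_difference_by_parts:
  fixes x \<epsilon> N :: real
  assumes e: "0 < \<epsilon>" "\<epsilon> \<le> N"
  defines "D \<equiv> second_difference (profile_primitive \<gamma>) x"
  shows "integral {\<epsilon>..N} (\<lambda>z. D z / z powr (1 + 2 * \<gamma>))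
    = (D \<epsilon> * \<epsilon> powr - (2 * \<gamma>) - D N * N powr - (2 * \<gamma>)
       + (integral {\<epsilon>..N} (\<lambda>z. profile \<gamma> (x + z) * z powr - (2 * \<gamma>))
        - integral {\<epsilon>..N} (\<lambda>z. profile \<gamma> (x - z) * z powr - (2 * \<gamma>)))) / (2 * \<gamma>)"
proof -
  let ?F = "\<lambda>z. - (D z * z powr - (2 * \<gamma>)) / (2 * \<gamma>)"
  let ?a = "\<lambda>z. profile \<gamma> (x + z) * z powr - (2 * \<gamma>)"
  let ?b = "\<lambda>z. profile \<gamma> (x - z) * z powr - (2 * \<gamma>)"
  let ?k = "\<lambda>z. D z / z powr (1 + 2 * \<gamma>)"
  have dP: "((\<lambda>z. profile_primitive \<gamma> (c + d * z)) has_real_derivative profile \<gamma> (c + d * z) * d) (at z)" for c d z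
    by (rule DERIV_chain2[OF has_derivative_profile_primitive[OF \<gamma>(1)]]) (auto intro!: derivative_eq_intros)
  have dD: "(D has_real_derivative profile \<gamma> (x + z) - profile \<gamma> (x - z)) (at z)" for z
    using DERIV_diff[OF DERIV_add[OF dP[of x 1 z] dP[of x "-1" z]] DERIV_const[of "2 * profile_primitive \<gamma> x"]]
    unfolding D_def second_difference_def by simp
  have dF: "(?F has_real_derivative ?k z - (?a z - ?b z) / (2 * \<gamma>)) (at z)" if z: "0 < z" for z
  proof -
    have "((\<lambda>z. z powr - (2 * \<gamma>)) has_real_derivative - (2 * \<gamma>) * z powr (- (2 * \<gamma>) - 1)) (at z)"
      using z by (intro has_real_derivative_powr)
    from DERIV_cdivide[OF DERIV_minus[OF DERIV_mult[OF dD this]], of "2 * \<gamma>"]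
    have "(?F has_real_derivative
      - ((profile \<gamma> (x + z) - profile \<gamma> (x - z)) * z powr - (2 * \<gamma>) + - (2 * \<gamma>) * z powr (- (2 * \<gamma>) - 1) * D z) / (2 * \<gamma>)) (at z)"
      by (simp add: mult.commute)
    moreover have "z powr (- (2 * \<gamma>) - 1) = 1 / z powr (1 + 2 * \<gamma>)"
    proof -
      have "- (2 * \<gamma>) - 1 = - (1 + 2 * \<gamma>)" by simp
      then show ?thesis by (simp only: powr_minus_divide)
    qed
    ultimately show ?thesis using \<gamma> by (simp add: field_simps)
  qed
  have contD: "continuous_on S D" for S
    by (intro continuous_at_imp_continuous_on ballI DERIV_isCont[OF dD])
  have ia: "?a integrable_on {\<epsilon>..N}"
    using e \<gamma> by (intro integrable_continuous_interval continuous_intros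
        continuous_on_compose2[OF continuous_on_profile[of \<gamma> UNIV]]) auto
  have ib: "?b integrable_on {\<epsilon>..N}"
    using e \<gamma> by (intro integrable_continuous_interval continuous_intros
        continuous_on_compose2[OF continuous_on_profile[of \<gamma> UNIV]]) auto
  have ik: "?k integrable_on {\<epsilon>..N}"
    using e by (intro integrable_continuous_interval continuous_intros contD) auto
  have "((\<lambda>z. ?k z - (?a z - ?b z) / (2 * \<gamma>)) has_integral ?F N - ?F \<epsilon>) {\<epsilon>..N}"
  proof (rule fundamental_theorem_of_calculus[OF e(2)])
    fix z assume "z \<in> {\<epsilon>..N}"
    then show "(?F has_vector_derivative ?k z - (?a z - ?b z) / (2 * \<gamma>)) (at z within {\<epsilon>..N})"
      using e by (intro has_vector_derivative_at_within[OF dF[unfolded has_real_derivative_iff_has_vector_derivative]]) auto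
  qed
  then have "?F N - ?F \<epsilon> = integral {\<epsilon>..N} (\<lambda>z. ?k z - (?a z - ?b z) / (2 * \<gamma>))"
    by (simp add: integral_unique)
  also have "\<dots> = integral {\<epsilon>..N} ?k - integral {\<epsilon>..N} (\<lambda>z. (?a z - ?b z) / (2 * \<gamma>))"
    by (intro Henstock_Kurzweil_Integration.integral_diff ik integrable_on_divide Henstock_Kurzweil_Integration.integrable_diff ia ib)
  also have "integral {\<epsilon>..N} (\<lambda>z. (?a z - ?b z) / (2 * \<gamma>)) = (integral {\<epsilon>..N} ?a - integral {\<epsilon>..N} ?b) / (2 * \<gamma>)"
    by (simp only: Henstock_Kurzweil_Integration.integral_divide Henstock_Kurzweil_Integration.integral_diff[OF ia ib])
  finally show ?thesis using \<gamma> by (simp add: field_simps)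
qed

end

lemma truncated_integral_limit:
  fixes f :: "real \<Rightarrow> real"
  assumes int: "integrable lborel f"
    and e: "\<And>n. 0 < \<epsilon> n" "\<epsilon> \<longlonglongrightarrow> 0" and N: "filterlim N at_top sequentially"
  shows "(\<lambda>n. integral {\<epsilon> n..N n} f) \<longlonglongrightarrow> (LINT z|lborel. indicat_real {0<..} z * f z)"
proof -
  have [measurable]: "f \<in> borel_measurable borel" using borel_measurable_integrable[OF int] by simp
  have "(\<lambda>n. LINT z|lborel. indicat_real {\<epsilon> n..N n} z * f z) \<longlonglongrightarrow> (LINT z|lborel. indicat_real {0<..} z * f z)"
  proof (rule integral_dominated_convergence[where w = "\<lambda>z. \<bar>f z\<bar>"])
    show "AE z in lborel. (\<lambda>n. indicat_real {\<epsilon> n..N n} z * f z) \<longlonglongrightarrow> indicat_real {0<..} z * f z"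
    proof (rule AE_I2)
      fix z :: real
      have "\<forall>\<^sub>F n in sequentially. indicat_real {\<epsilon> n..N n} z * f z = indicat_real {0<..} z * f z"
      proof (cases "0 < z")
        case True
        have "\<forall>\<^sub>F n in sequentially. \<epsilon> n < z" by (rule order_tendstoD(2)[OF e(2) True])
        moreover have "\<forall>\<^sub>F n in sequentially. z \<le> N n" using N by (simp add: filterlim_at_top)
        ultimately show ?thesis by eventually_elim (use True in auto)
      next
        case False
        have "z \<notin> {\<epsilon> n..N n}" for n using e(1)[of n] False by auto
        then show ?thesis using False by simp
      qed
      then show "(\<lambda>n. indicat_real {\<epsilon> n..N n} z * f z) \<longlonglongrightarrow> indicat_real {0<..} z * f z"
        by (rule tendsto_eventually)
    qed
    show "AE z in lborel. norm (indicat_real {\<epsilon> n..N n} z * f z) \<le> \<bar>f z\<bar>" for n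
      by (auto simp: indicator_def)
  qed (use int in auto)
  moreover have "(LINT z|lborel. indicat_real {\<epsilon> n..N n} z * f z) = integral {\<epsilon> n..N n} f" for n
  proof -
    have "set_integrable lborel {\<epsilon> n..N n} f"
      unfolding set_integrable_def by (rule integrable_mult_indicator) (use int in auto)
    from set_borel_integral_eq_integral(2)[OF this] show ?thesis
      by (simp add: set_lebesgue_integral_def)
  qed
  ultimately show ?thesis by simp
qed

lemma integral_even_half_line:
  fixes f :: "real \<Rightarrow> real"
  assumes int: "integrable lborel f" and even: "\<And>z. f (- z) = f z" and f0: "f 0 = 0"
  shows "(LINT z|lborel. f z) = 2 * (LINT z|lborel. indicat_real {0<..} z * f z)"
proof -
  let ?p = "\<lambda>z. indicat_real {0<..} z * f z"
  have ip: "integrable lborel ?p"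
    using integrable_mult_indicator[OF _ int, of "{0<..}"] by simp
  have im: "integrable lborel (\<lambda>z. ?p (0 + (-1) * z))" by (rule lborel_integrable_real_affine[OF ip]) simp
  have "f z = ?p z + ?p (0 + (-1) * z)" for z
    using f0 even[of z] by (cases z "0::real" rule: linorder_cases) auto
  then have "(LINT z|lborel. f z) = (LINT z|lborel. ?p z + ?p (0 + (-1) * z))" by simp
  also have "\<dots> = (LINT z|lborel. ?p z) + (LINT z|lborel. ?p (0 + (-1) * z))"
    by (rule Bochner_Integration.integral_add[OF ip im])
  also have "(LINT z|lborel. ?p (0 + (-1) * z)) = (LINT z|lborel. ?p z)"
    by (subst (2) lborel_integral_real_affine[where c = "-1" and t = 0]) auto
  finally show ?thesis by simp
qed

context
  fixes \<gamma> :: real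
  assumes \<gamma>: "0 < \<gamma>" "\<gamma> < 1"
begin

lemma scaled_primitive_has_derivative:
  "((\<lambda>y. c * profile_primitive \<gamma> (y / R)) has_real_derivative c / R * profile \<gamma> (y / R)) (at y)"
proof -
  have "((\<lambda>y. y / R) has_real_derivative 1 / R) (at y)"
    by (rule DERIV_cdivide[OF DERIV_ident])
  from DERIV_cmult[OF DERIV_chain2[OF has_derivative_profile_primitive[OF \<gamma>(1)] this], of c]
  show ?thesis by simp
qed

lemma scaled_primitive_levy_integrable:
  fixes c R y :: real
  assumes R: "0 < R" and y: "\<bar>y\<bar> < R"
  defines "\<Phi> \<equiv> \<lambda>y. c * profile_primitive \<gamma> (y / R)"
  shows "integrable lborel (\<lambda>z. (\<Phi> (y + z) - \<Phi> y - z * deriv \<Phi> y * indicat_real {z. \<bar>z\<bar> \<le> 1} z)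
                                  / \<bar>z\<bar> powr (1 + 2 * \<gamma>))"
proof -
  \<comment> \<open>The midpoint between \<open>\<bar>y/R\<bar>\<close> and 1, which leaves room on both sides.\<close>
  define r where "r = (1 + \<bar>y / R\<bar>) / 2"
  define \<delta> where "\<delta> = min 1 (R * (1 - \<bar>y / R\<bar>) / 2)"
  have yR: "\<bar>y / R\<bar> < 1" using R y by simp
  have r1: "r < 1" using yR by (simp add: r_def)
  have near: "\<bar>t / R\<bar> \<le> r" "\<bar>y / R\<bar> \<le> r" if t: "\<bar>t - y\<bar> \<le> \<delta>" for t
  proof -
    have "\<bar>t - y\<bar> \<le> R * (1 - \<bar>y / R\<bar>) / 2" using t by (simp add: \<delta>_def)
    then have "\<bar>t - y\<bar> / R \<le> (1 - \<bar>y / R\<bar>) / 2" using R by (simp add: divide_le_eq mult.commute)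
    then have "\<bar>t / R - y / R\<bar> \<le> (1 - \<bar>y / R\<bar>) / 2" using R by (simp add: diff_divide_distrib[symmetric])
    moreover have "r = \<bar>y / R\<bar> + (1 - \<bar>y / R\<bar>) / 2" by (simp add: r_def field_simps)
    ultimately show "\<bar>t / R\<bar> \<le> r" by linarith
    have "t \<le> (1 + t) / 2" if "t < 1" for t :: real using that by simp
    from this[OF yR] show "\<bar>y / R\<bar> \<le> r" unfolding r_def .
  qed
  define L where "L = \<bar>c / R\<bar> * (2 * \<gamma> * (1 - r\<^sup>2) powr (\<gamma> - 1) / R)"
  have der: "(\<Phi> has_real_derivative c / R * profile \<gamma> (t / R)) (at t)" for t
    unfolding \<Phi>_def by (rule scaled_primitive_has_derivative)
  have "continuous_on UNIV \<Phi>" by (intro continuous_at_imp_continuous_on ballI DERIV_isCont[OF der])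
  then have meas: "\<Phi> \<in> borel_measurable borel" by (rule borel_measurable_continuous_onI)
  have "integrable lborel (\<lambda>z. (\<Phi> (y + z) - \<Phi> y - z * (c / R * profile \<gamma> (y / R)) * indicat_real {z. \<bar>z\<bar> \<le> 1} z)
                                  / \<bar>z\<bar> powr (1 + 2 * \<gamma>))"
  proof (rule levy_integrand_integrable[where B = "\<bar>c\<bar> * profile_mass \<gamma>" and \<delta> = \<delta> and L = L])
    show "\<bar>\<Phi> t\<bar> \<le> \<bar>c\<bar> * profile_mass \<gamma>" for t
      unfolding \<Phi>_def abs_mult using profile_primitive_bounds[OF \<gamma>(1), of "t / R"]
      by (intro mult_left_mono) auto
    show "0 < \<delta>" "\<delta> \<le> 1" using R yR by (auto simp: \<delta>_def)
    fix t assume t: "\<bar>t - y\<bar> \<le> \<delta>"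
    have "\<bar>profile \<gamma> (t / R) - profile \<gamma> (y / R)\<bar> \<le> 2 * \<gamma> * (1 - r\<^sup>2) powr (\<gamma> - 1) * \<bar>t / R - y / R\<bar>"
      using \<gamma> r1 near[OF t] by (intro profile_locally_lipschitz) auto
    also have "\<bar>t / R - y / R\<bar> = \<bar>t - y\<bar> / R" using R by (simp add: diff_divide_distrib[symmetric])
    finally have "\<bar>c / R\<bar> * \<bar>profile \<gamma> (t / R) - profile \<gamma> (y / R)\<bar>
        \<le> \<bar>c / R\<bar> * (2 * \<gamma> * (1 - r\<^sup>2) powr (\<gamma> - 1) * (\<bar>t - y\<bar> / R))"
      by (intro mult_left_mono) auto
    then show "\<bar>c / R * profile \<gamma> (t / R) - c / R * profile \<gamma> (y / R)\<bar> \<le> L * \<bar>t - y\<bar>"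
      unfolding right_diff_distrib[symmetric] abs_mult L_def by simp
  qed (use \<gamma> meas der in auto)
  then show ?thesis using DERIV_imp_deriv[OF der] by simp
qed

lemma second_difference_primitive_integrable:
  assumes "\<bar>x\<bar> < 1"
  shows "integrable lborel (\<lambda>z. second_difference (profile_primitive \<gamma>) x z / \<bar>z\<bar> powr (1 + 2 * \<gamma>))"
  using levy_integral_second_difference(1)[OF scaled_primitive_levy_integrable[of 1 x 1]] assms by simp

text \<open>The mean value theorem on both sides gives \<open>z\<close> times a difference of values of the profile at
  distance at most \<open>2\<bar>z\<bar>\<close>.\<close>

lemma second_difference_primitive_quadratic:
  assumes x: "\<bar>x\<bar> < 1"
  shows "\<exists>L. \<forall>\<^sub>F z in nhds 0. \<bar>second_difference (profile_primitive \<gamma>) x z\<bar> \<le> L * z\<^sup>2"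
proof -
  define r where "r = (1 + \<bar>x\<bar>) / 2"
  define L where "L = 2 * \<gamma> * (1 - r\<^sup>2) powr (\<gamma> - 1)"
  have r: "\<bar>x\<bar> < r" "r < 1" using x by (auto simp: r_def)
  note d = has_derivative_profile_primitive[OF \<gamma>(1)]
  have "\<bar>second_difference (profile_primitive \<gamma>) x z\<bar> \<le> 2 * L * z\<^sup>2" if z: "\<bar>z\<bar> < r - \<bar>x\<bar>" for z
  proof -
    let ?P = "profile_primitive \<gamma>"
    have "\<exists>y. \<bar>y - x\<bar> \<le> \<bar>z\<bar> \<and> ?P (x + z) - ?P x = z * profile \<gamma> y"
      by (rule mean_value_increment) (rule d)
    then obtain y1 where y1: "\<bar>y1 - x\<bar> \<le> \<bar>z\<bar>" "?P (x + z) - ?P x = z * profile \<gamma> y1" by blast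
    have "\<exists>y. \<bar>y - x\<bar> \<le> \<bar>-z\<bar> \<and> ?P (x + (-z)) - ?P x = (-z) * profile \<gamma> y"
      by (rule mean_value_increment) (rule d)
    then obtain y2 where y2: "\<bar>y2 - x\<bar> \<le> \<bar>z\<bar>" "?P (x - z) - ?P x = - z * profile \<gamma> y2" by auto
    have "second_difference ?P x z = z * (profile \<gamma> y1 - profile \<gamma> y2)"
      using y1 y2 by (simp add: second_difference_def algebra_simps)
    then have "\<bar>second_difference ?P x z\<bar> = \<bar>z\<bar> * \<bar>profile \<gamma> y1 - profile \<gamma> y2\<bar>" by (simp add: abs_mult)
    also have "\<dots> \<le> \<bar>z\<bar> * (L * \<bar>y1 - y2\<bar>)"
      unfolding L_def using y1 y2 z r \<gamma> by (intro mult_left_mono profile_locally_lipschitz) linarith+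
    also have "\<dots> \<le> \<bar>z\<bar> * (L * (2 * \<bar>z\<bar>))"
      using y1 y2 \<gamma> by (intro mult_left_mono) (auto simp: L_def)
    also have "\<dots> = 2 * L * (\<bar>z\<bar> * \<bar>z\<bar>)" by simp
    finally show ?thesis by (simp only: abs_mult_self_eq power2_eq_square)
  qed
  then have "\<forall>z. dist z 0 < r - \<bar>x\<bar> \<longrightarrow> \<bar>second_difference (profile_primitive \<gamma>) x z\<bar> \<le> 2 * L * z\<^sup>2"
    by (simp add: dist_real_def)
  then show ?thesis using r unfolding eventually_nhds_metric
    by (intro exI[of _ "2 * L"] exI[of _ "r - \<bar>x\<bar>"]) auto
qed

lemma second_difference_primitive_bound:
  "\<bar>second_difference (profile_primitive \<gamma>) x z\<bar> \<le> 2 * profile_mass \<gamma>"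
  using profile_primitive_bounds[OF \<gamma>(1), of "x + z"] profile_primitive_bounds[OF \<gamma>(1), of "x - z"]
    profile_primitive_bounds[OF \<gamma>(1), of x]
  by (simp add: second_difference_def abs_le_iff)

text \<open>Take cutoffs given by \<open>\<tau> = 1/(n+2)\<close> and integrate up to \<open>N = n+2\<close>. In the limit both boundary terms of
  the integration by parts vanish, since the second difference is quadratic at zero and bounded at
  infinity, and the main term is the truncated odd convolution. For \<open>x \<ge> 0\<close> the cutoff on the right is
  the smaller one, which makes the error \<open>\<eta>\<close> an integral over the gap between the cutoffs.\<close>

lemma second_difference_integral_nonneg:
  assumes x: "0 \<le> x" "x < 1"
  shows "(LINT z|lborel. second_difference (profile_primitive \<gamma>) x z / \<bar>z\<bar> powr (1 + 2 * \<gamma>))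
       = - (4 * getoor_const \<gamma> / \<gamma>) * x"
proof -
  have x': "\<bar>x\<bar> < 1" using x by simp
  define D where "D = second_difference (profile_primitive \<gamma>) x"
  define Q where "Q = 1 - x\<^sup>2"
  have Q: "0 < Q" using x' by (simp add: Q_def abs_square_less_1)
  let ?a = "\<lambda>z. profile \<gamma> (x + z) * z powr - (2 * \<gamma>)"
  let ?b = "\<lambda>z. profile \<gamma> (x - z) * z powr - (2 * \<gamma>)"
  define \<tau> where "\<tau> = (\<lambda>n. 1 / (real n + 2))"
  define N where "N = (\<lambda>n. real n + 2)"
  define s where "s = (\<lambda>n. disc_rescale x (\<tau> n))"
  define \<epsilon> where "\<epsilon> = (\<lambda>n. moebius_shift x (s n))"
  define \<epsilon>' where "\<epsilon>' = (\<lambda>n. moebius_shift (- x) (s n))"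
  have \<tau>: "0 < \<tau> n" "\<tau> n \<le> 1" for n by (auto simp: \<tau>_def)
  have \<tau>0: "\<tau> \<longlonglongrightarrow> 0" unfolding \<tau>_def by real_asymp
  have N2: "2 \<le> N n" for n by (simp add: N_def)
  have Ninf: "filterlim N at_top sequentially" unfolding N_def by real_asymp
  have s: "0 < s n" "s n \<le> 1" for n
    using disc_rescale_pos[OF x' \<tau>(1)] disc_rescale_mono[OF x' \<tau>(2)] by (auto simp: s_def disc_rescale_one)
  have "isCont (disc_rescale x) 0"
    by (rule DERIV_isCont[OF disc_rescale_has_derivative[OF x']])
  from isCont_tendsto_compose[OF this \<tau>0] have s0: "s \<longlonglongrightarrow> 0"
    unfolding s_def by (simp add: disc_rescale_def)
  have \<epsilon>: "0 < \<epsilon> n" for n unfolding \<epsilon>_def by (rule moebius_shift_pos[OF x' s])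
  have \<epsilon>s: "\<epsilon> n \<le> 2 * s n" "\<epsilon>' n \<le> 2 * s n" for n
    using moebius_shift_le[of x "s n"] moebius_shift_le[of "- x" "s n"] x' s[of n]
    by (auto simp: \<epsilon>_def \<epsilon>'_def)
  have \<epsilon>\<epsilon>: "\<epsilon> n \<le> \<epsilon>' n" "\<epsilon>' n - \<epsilon> n \<le> 2 * (s n)\<^sup>2" for n
    unfolding \<epsilon>_def \<epsilon>'_def using s[of n] moebius_shift_asymmetry(2,3)[OF x' _ _ x(1), of "s n"] by auto
  have \<epsilon>N: "\<epsilon>' n \<le> N n" for n using \<epsilon>s(2)[of n] s(2)[of n] N2[of n] by linarith
  have \<epsilon>0: "\<epsilon> \<longlonglongrightarrow> 0"
  proof (rule tendsto_sandwich[where f = "\<lambda>_. 0" and h = "\<lambda>n. 2 * s n"])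
    show "(\<lambda>n. 2 * s n) \<longlonglongrightarrow> 0" using tendsto_mult_left[OF s0, of 2] by simp
    show "\<forall>\<^sub>F n in sequentially. 0 \<le> \<epsilon> n" using \<epsilon> by (simp add: less_imp_le)
    show "\<forall>\<^sub>F n in sequentially. \<epsilon> n \<le> 2 * s n" using \<epsilon>s by simp
  qed simp

  \<comment> \<open>The two truncation points differ only to second order.\<close>
  define \<eta> where "\<eta> = (\<lambda>n. integral {\<epsilon> n..\<epsilon>' n} ?b)"
  have ib: "?b integrable_on {u..v}" if "0 < u" for u v
    using that \<gamma> by (intro integrable_continuous_interval continuous_intros
        continuous_on_compose2[OF continuous_on_profile[of \<gamma> UNIV]]) auto
  have \<eta>: "\<bar>\<eta> n\<bar> \<le> 2 * (Q / 2) powr - (2 * \<gamma>) * s n powr (2 - 2 * \<gamma>)" for n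
  proof -
    have low: "s n * Q / 2 \<le> \<epsilon> n"
      unfolding \<epsilon>_def Q_def using s[of n] by (intro moebius_shift_ge[OF x']) auto
    have "norm (integral {\<epsilon> n..\<epsilon>' n} ?b) \<le> \<epsilon> n powr - (2 * \<gamma>) * (\<epsilon>' n - \<epsilon> n)"
    proof (rule integral_bound[OF \<epsilon>\<epsilon>(1)])
      show "continuous_on {\<epsilon> n..\<epsilon>' n} ?b" using \<epsilon>[of n] \<gamma>
        by (intro continuous_intros continuous_on_compose2[OF continuous_on_profile[of \<gamma> UNIV]]) auto
      fix z assume z: "z \<in> {\<epsilon> n..\<epsilon>' n}"
      have "profile \<gamma> (x - z) * z powr - (2 * \<gamma>) \<le> 1 * \<epsilon> n powr - (2 * \<gamma>)"
        using z \<epsilon>[of n] \<gamma> by (intro mult_mono profile_le_one powr_mono2') auto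
      then show "norm (?b z) \<le> \<epsilon> n powr - (2 * \<gamma>)" by (simp add: profile_nonneg)
    qed
    also have "\<dots> \<le> (s n * Q / 2) powr - (2 * \<gamma>) * (2 * (s n)\<^sup>2)"
      using low \<epsilon>\<epsilon>[of n] s[of n] Q \<gamma> by (intro mult_mono powr_mono2') auto
    also have "\<dots> = 2 * (Q / 2) powr - (2 * \<gamma>) * (s n powr - (2 * \<gamma>) * s n powr 2)"
      using s(1)[of n] Q powr_mult[of "s n" "Q / 2" "- (2 * \<gamma>)"] by simp
    also have "s n powr - (2 * \<gamma>) * s n powr 2 = s n powr (2 - 2 * \<gamma>)"
      by (simp add: powr_add[symmetric])
    finally show ?thesis by (simp add: \<eta>_def)
  qed
  have "(\<lambda>n. s n powr (2 - 2 * \<gamma>)) \<longlonglongrightarrow> 0"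
    by (rule tendsto_zero_powrI[OF s0 tendsto_const]) (use s \<gamma> in \<open>auto intro!: always_eventually less_imp_le\<close>)
  from tendsto_mult_left[OF this] have "(\<lambda>n. 2 * (Q / 2) powr - (2 * \<gamma>) * s n powr (2 - 2 * \<gamma>)) \<longlonglongrightarrow> 0" by simp
  then have \<eta>0: "\<eta> \<longlonglongrightarrow> 0"
    by (rule Lim_null_comparison[rotated]) (use \<eta> in \<open>auto intro!: always_eventually\<close>)

  have lower0: "(\<lambda>n. D (\<epsilon> n) * \<epsilon> n powr - (2 * \<gamma>)) \<longlonglongrightarrow> 0"
  proof -
    obtain L where "\<forall>\<^sub>F z in nhds 0. \<bar>D z\<bar> \<le> L * z\<^sup>2"
      using second_difference_primitive_quadratic[OF x'] by (auto simp: D_def)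
    then have "\<forall>\<^sub>F n in sequentially. \<bar>D (\<epsilon> n)\<bar> \<le> L * (\<epsilon> n)\<^sup>2"
      using \<epsilon>0 by (rule eventually_compose_filterlim)
    then have "\<forall>\<^sub>F n in sequentially. norm (D (\<epsilon> n) * \<epsilon> n powr - (2 * \<gamma>)) \<le> L * \<epsilon> n powr (2 - 2 * \<gamma>)"
    proof eventually_elim
      case (elim n)
      have "\<bar>D (\<epsilon> n)\<bar> * \<epsilon> n powr - (2 * \<gamma>) \<le> (L * (\<epsilon> n)\<^sup>2) * \<epsilon> n powr - (2 * \<gamma>)"
        using elim by (rule mult_right_mono) simp
      also have "\<dots> = L * (\<epsilon> n powr 2 * \<epsilon> n powr - (2 * \<gamma>))" using \<epsilon>[of n] by simp
      also have "\<epsilon> n powr 2 * \<epsilon> n powr - (2 * \<gamma>) = \<epsilon> n powr (2 - 2 * \<gamma>)" by (simp add: powr_add[symmetric])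
      finally show ?case by (simp add: abs_mult)
    qed
    moreover have "(\<lambda>n. L * \<epsilon> n powr (2 - 2 * \<gamma>)) \<longlonglongrightarrow> 0"
    proof -
      have "(\<lambda>n. \<epsilon> n powr (2 - 2 * \<gamma>)) \<longlonglongrightarrow> 0"
        by (rule tendsto_zero_powrI[OF \<epsilon>0 tendsto_const]) (use \<epsilon> \<gamma> in \<open>auto intro!: always_eventually less_imp_le\<close>)
      from tendsto_mult_left[OF this] show ?thesis by simp
    qed
    ultimately show ?thesis by (rule Lim_null_comparison)
  qed
  have upper0: "(\<lambda>n. D (N n) * N n powr - (2 * \<gamma>)) \<longlonglongrightarrow> 0"
  proof (rule Lim_null_comparison)
    have "\<bar>D (N n)\<bar> * N n powr - (2 * \<gamma>) \<le> (2 * profile_mass \<gamma>) * N n powr - (2 * \<gamma>)" for n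
      unfolding D_def by (intro mult_right_mono second_difference_primitive_bound) auto
    then show "\<forall>\<^sub>F n in sequentially. norm (D (N n) * N n powr - (2 * \<gamma>)) \<le> (2 * profile_mass \<gamma>) * N n powr - (2 * \<gamma>)"
      by (simp add: abs_mult)
    have "(\<lambda>n. N n powr - (2 * \<gamma>)) \<longlonglongrightarrow> 0" by (rule tendsto_neg_powr[OF _ Ninf]) (use \<gamma> in auto)
    from tendsto_mult_left[OF this] show "(\<lambda>n. (2 * profile_mass \<gamma>) * N n powr - (2 * \<gamma>)) \<longlonglongrightarrow> 0" by simp
  qed

  let ?T = "\<lambda>n. integral {\<tau> n..1} (\<lambda>\<rho>. \<rho> powr (1 - 2 * \<gamma>) * profile \<gamma> \<rho>)"
  have parts: "integral {\<epsilon> n..N n} (\<lambda>z. D z / z powr (1 + 2 * \<gamma>))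
      = (D (\<epsilon> n) * \<epsilon> n powr - (2 * \<gamma>) - D (N n) * N n powr - (2 * \<gamma>) + (- 4 * x * ?T n - \<eta> n)) / (2 * \<gamma>)" for n
  proof -
    have "\<epsilon> n \<le> N n" using \<epsilon>\<epsilon>(1)[of n] \<epsilon>N[of n] by linarith
    note second_difference_by_parts[OF \<gamma> \<epsilon> this, of x, folded D_def]
    moreover have "integral {\<epsilon> n..\<epsilon>' n} ?b + integral {\<epsilon>' n..N n} ?b = integral {\<epsilon> n..N n} ?b"
      using \<epsilon>\<epsilon>(1)[of n] \<epsilon>N[of n] \<epsilon>[of n] by (intro Henstock_Kurzweil_Integration.integral_combine ib) auto
    moreover have "integral {\<epsilon> n..N n} ?a - integral {\<epsilon>' n..N n} ?b = - 4 * x * ?T n"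
      unfolding \<epsilon>_def \<epsilon>'_def s_def by (rule truncated_odd_convolution[OF \<gamma> x' \<tau> N2])
    ultimately show ?thesis by (simp add: \<eta>_def)
  qed
  have "(\<lambda>n. integral {\<epsilon> n..N n} (\<lambda>z. D z / z powr (1 + 2 * \<gamma>)))
      \<longlonglongrightarrow> (0 - 0 + (- 4 * x * getoor_const \<gamma> - 0)) / (2 * \<gamma>)"
    unfolding parts using \<gamma>
    by (intro tendsto_intros lower0 upper0 \<eta>0 getoor_const_limit[OF \<gamma> \<tau>0 \<tau>]) auto
  moreover have "integral {\<epsilon> n..N n} (\<lambda>z. D z / z powr (1 + 2 * \<gamma>))
      = integral {\<epsilon> n..N n} (\<lambda>z. D z / \<bar>z\<bar> powr (1 + 2 * \<gamma>))" for n
    using \<epsilon>[of n] by (intro Henstock_Kurzweil_Integration.integral_cong) auto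
  moreover have int: "integrable lborel (\<lambda>z. D z / \<bar>z\<bar> powr (1 + 2 * \<gamma>))"
    unfolding D_def by (rule second_difference_primitive_integrable[OF x'])
  moreover note truncated_integral_limit[OF int \<epsilon> \<epsilon>0 Ninf]
  ultimately have half: "(LINT z|lborel. indicat_real {0<..} z * (D z / \<bar>z\<bar> powr (1 + 2 * \<gamma>)))
      = (0 - 0 + (- 4 * x * getoor_const \<gamma> - 0)) / (2 * \<gamma>)"
    using LIMSEQ_unique by simp
  have "(LINT z|lborel. D z / \<bar>z\<bar> powr (1 + 2 * \<gamma>))
      = 2 * (LINT z|lborel. indicat_real {0<..} z * (D z / \<bar>z\<bar> powr (1 + 2 * \<gamma>)))"
    by (rule integral_even_half_line[OF int]) (auto simp: D_def second_difference_def)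
  then show ?thesis unfolding half by (simp add: D_def)
qed

text \<open>The second difference of the primitive is odd in \<open>x\<close>, because the profile is even.\<close>

lemma second_difference_integral:
  assumes x: "\<bar>x\<bar> < 1"
  shows "(LINT z|lborel. second_difference (profile_primitive \<gamma>) x z / \<bar>z\<bar> powr (1 + 2 * \<gamma>))
       = - (4 * getoor_const \<gamma> / \<gamma>) * x"
proof (cases "0 \<le> x")
  case True
  then show ?thesis using x by (intro second_difference_integral_nonneg) auto
next
  case False
  have "second_difference (profile_primitive \<gamma>) (- x) z = - second_difference (profile_primitive \<gamma>) x z" for z
    using profile_primitive_reflect[OF \<gamma>(1), of x] profile_primitive_reflect[OF \<gamma>(1), of "x - z"]
      profile_primitive_reflect[OF \<gamma>(1), of "x + z"] by (simp add: second_difference_def)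
  then show ?thesis using second_difference_integral_nonneg[of "- x"] False x by simp
qed

text \<open>The kernel is homogeneous of degree \<open>-1 - 2\<gamma>\<close>, so rescaling by \<open>R\<close> gives \<open>R^(-2\<gamma>)\<close>; one further
  power of \<open>R\<close> comes from evaluating the linear function at \<open>y/R\<close>.\<close>

lemma levy_integral_scaled_primitive:
  assumes R: "0 < R" and y: "\<bar>y\<bar> < R"
  shows "levy_integral (2 * \<gamma>) (\<lambda>y. c * profile_primitive \<gamma> (y / R)) y
       = - (2 * c * getoor_const \<gamma> / (\<gamma> * R powr (1 + 2 * \<gamma>))) * y"
proof -
  let ?\<Phi> = "\<lambda>y. c * profile_primitive \<gamma> (y / R)"
  let ?k = "\<lambda>z::real. \<bar>z\<bar> powr (1 + 2 * \<gamma>)"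
  have "levy_integral (2 * \<gamma>) ?\<Phi> y = (LINT z|lborel. second_difference ?\<Phi> y z / ?k z) / 2"
    by (rule levy_integral_second_difference(2)[OF scaled_primitive_levy_integrable[OF R y]])
  also have "(LINT z|lborel. second_difference ?\<Phi> y z / ?k z)
      = R * (LINT t|lborel. second_difference ?\<Phi> y (0 + R * t) / ?k (0 + R * t))"
    using R by (subst lborel_integral_real_affine[where c = R and t = 0]) auto
  also have "(LINT t|lborel. second_difference ?\<Phi> y (0 + R * t) / ?k (0 + R * t))
      = (LINT t|lborel. (c / R powr (1 + 2 * \<gamma>)) * (second_difference (profile_primitive \<gamma>) (y / R) t / ?k t))"
  proof (rule Bochner_Integration.integral_cong)
    fix t
    have "second_difference ?\<Phi> y (0 + R * t) = c * second_difference (profile_primitive \<gamma>) (y / R) t"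
      using R by (simp add: second_difference_def add_divide_distrib diff_divide_distrib algebra_simps)
    moreover have "?k (0 + R * t) = R powr (1 + 2 * \<gamma>) * ?k t" using R by (simp add: abs_mult powr_mult)
    ultimately show "second_difference ?\<Phi> y (0 + R * t) / ?k (0 + R * t)
      = (c / R powr (1 + 2 * \<gamma>)) * (second_difference (profile_primitive \<gamma>) (y / R) t / ?k t)" by simp
  qed simp
  also have "\<dots> = (c / R powr (1 + 2 * \<gamma>)) * (- (4 * getoor_const \<gamma> / \<gamma>) * (y / R))"
    unfolding integral_mult_right_zero by (subst second_difference_integral) (use R y in auto)
  finally show ?thesis using R \<gamma> by (simp add: field_simps)
qed

end

lemma C1_holder_scaled_primitive:
  assumes \<gamma>: "0 < \<gamma>" "\<gamma> < 1" and R: "0 < R"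
  shows "C1_holder_at \<gamma> (\<lambda>y. c * profile_primitive \<gamma> (y / R)) x"
proof -
  let ?\<Phi> = "\<lambda>y. c * profile_primitive \<gamma> (y / R)"
  note d = scaled_primitive_has_derivative[OF \<gamma>, of c R]
  have D: "deriv ?\<Phi> = (\<lambda>y. c / R * profile \<gamma> (y / R))" by (rule ext) (rule DERIV_imp_deriv[OF d])
  have "\<bar>c / R * profile \<gamma> (u / R) - c / R * profile \<gamma> (v / R)\<bar>
      \<le> \<bar>c / R\<bar> * 2 powr \<gamma> / R powr \<gamma> * \<bar>u - v\<bar> powr \<gamma>" for u v
  proof -
    have "\<bar>c / R\<bar> * \<bar>profile \<gamma> (u / R) - profile \<gamma> (v / R)\<bar> \<le> \<bar>c / R\<bar> * (2 powr \<gamma> * \<bar>u / R - v / R\<bar> powr \<gamma>)"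
      using \<gamma> by (intro mult_left_mono profile_holder) auto
    also have "\<bar>u / R - v / R\<bar> powr \<gamma> = \<bar>u - v\<bar> powr \<gamma> / R powr \<gamma>"
      using R by (simp add: diff_divide_distrib[symmetric] powr_divide)
    finally show ?thesis unfolding right_diff_distrib[symmetric] abs_mult[symmetric]
      by (simp add: abs_mult mult.assoc)
  qed
  then show ?thesis unfolding C1_holder_at_def D
    using d real_differentiable_def
    by (intro exI[of _ UNIV] conjI ballI exI[of _ "\<bar>c / R\<bar> * 2 powr \<gamma> / R powr \<gamma>"] open_UNIV UNIV_I
        continuous_intros continuous_on_compose2[OF continuous_on_profile[of \<gamma> UNIV]] \<gamma>) (use R in auto)
qed

theorem theorem1p1:
  fixes \<alpha> :: real
  assumes "0 < \<alpha>" and "\<alpha> < 2"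
  shows "\<exists>y\<^sub>\<alpha> > (0::real). \<exists>\<Phi> :: real \<Rightarrow> real.
           mono \<Phi> \<and>
           (\<forall>x. C1_holder_at (\<alpha> / 2) \<Phi> x) \<and>
           real_analytic_on \<Phi> {- y\<^sub>\<alpha><..<y\<^sub>\<alpha>} \<and>
           (\<forall>y \<in> {..<- y\<^sub>\<alpha>}. \<Phi> y = 0) \<and>
           (\<forall>y \<in> {y\<^sub>\<alpha><..}. \<Phi> y = 1) \<and>
           (\<forall>y \<in> {- y\<^sub>\<alpha><..<y\<^sub>\<alpha>}. frac_laplacian \<alpha> \<Phi> y = y / (\<alpha> + 1))"
proof -
  define \<gamma> where "\<gamma> = \<alpha> / 2"
  have \<gamma>: "0 < \<gamma>" "\<gamma> < 1" and \<alpha>\<gamma>: "\<alpha> = 2 * \<gamma>" using assms by (auto simp: \<gamma>_def)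
  define M where "M = profile_mass \<gamma>"
  define G where "G = (\<alpha> + 1) * (levy_const \<alpha> * (2 * getoor_const \<gamma> / (M * \<gamma>)))"
  \<comment> \<open>On the interval the fractional Laplacian is \<open>y\<close> times \<open>G / ((\<alpha> + 1) R^(1+\<alpha>))\<close>, so \<open>R^(1+\<alpha>) = G\<close> is required.\<close>
  define R where "R = G powr (1 / (1 + \<alpha>))"
  define \<Phi> where "\<Phi> = (\<lambda>y. 1 / M * profile_primitive \<gamma> (y / R))"
  have M: "0 < M" unfolding M_def by (rule profile_mass_pos[OF \<gamma>(1)])
  have C: "0 < levy_const \<alpha>" by (rule levy_const_pos[OF assms])
  have K: "0 < getoor_const \<gamma>" by (rule getoor_const_pos[OF \<gamma>])
  have G: "0 < G" unfolding G_def using C K M \<gamma> assms by (intro mult_pos_pos divide_pos_pos) auto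
  have R: "0 < R" unfolding R_def using G by simp
  have RG: "R powr (1 + \<alpha>) = G" unfolding R_def using G assms by (simp add: powr_powr)
  have mono: "mono \<Phi>"
  proof (rule monoI)
    fix x y :: real assume "x \<le> y"
    then have "x / R \<le> y / R" using R by (intro divide_right_mono) auto
    then have "profile_primitive \<gamma> (x / R) \<le> profile_primitive \<gamma> (y / R)"
      by (rule monoD[OF mono_profile_primitive[OF \<gamma>(1)]])
    then show "\<Phi> x \<le> \<Phi> y" unfolding \<Phi>_def using M by (intro mult_left_mono) auto
  qed
  have holder: "C1_holder_at (\<alpha> / 2) \<Phi> x" for x
    unfolding \<Phi>_def \<gamma>_def[symmetric] by (rule C1_holder_scaled_primitive[OF \<gamma> R])
  have analytic: "real_analytic_on \<Phi> {- R<..<R}"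
    unfolding real_analytic_on_def
  proof
    fix x assume "x \<in> {- R<..<R}"
    then have "\<bar>x / R\<bar> < 1" using R by auto
    then obtain F where F: "(\<lambda>h. profile_primitive \<gamma> (x / R + 1 / R * h)) has_fps_expansion F"
      using profile_primitive_has_fps_expansion[OF \<gamma>(1)] by blast
    have "(\<lambda>h. 1 / M * profile_primitive \<gamma> (x / R + 1 / R * h)) = (\<lambda>h. \<Phi> (x + h))"
      by (simp add: \<Phi>_def add_divide_distrib)
    then show "\<exists>F. (\<lambda>h. \<Phi> (x + h)) has_fps_expansion F"
      using has_fps_expansion_cmult_left[OF F, of "1 / M"] by auto
  qed
  have left: "\<Phi> y = 0" if "y < - R" for y
  proof -
    have "y / R \<le> -1" using that R by (simp add: divide_le_eq)
    then show ?thesis by (simp add: \<Phi>_def profile_primitive_left[OF \<gamma>(1)])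
  qed
  have right: "\<Phi> y = 1" if "R < y" for y
  proof -
    have "1 \<le> y / R" using that R by simp
    then show ?thesis using M by (simp add: \<Phi>_def profile_primitive_right[OF \<gamma>(1)] M_def)
  qed
  have lap: "frac_laplacian \<alpha> \<Phi> y = y / (\<alpha> + 1)" if "\<bar>y\<bar> < R" for y
  proof -
    have "levy_integral \<alpha> \<Phi> y = - (2 * (1 / M) * getoor_const \<gamma> / (\<gamma> * R powr (1 + \<alpha>))) * y"
      unfolding \<Phi>_def \<alpha>\<gamma> by (rule levy_integral_scaled_primitive[OF \<gamma> R that])
    then have "frac_laplacian \<alpha> \<Phi> y = (levy_const \<alpha> * (2 * getoor_const \<gamma> / (M * \<gamma>))) / G * y"
      unfolding frac_laplacian_def RG by simp
    also have "\<dots> = y / (\<alpha> + 1)"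
      using C K M \<gamma> assms unfolding G_def by simp
    finally show ?thesis .
  qed
  show ?thesis
    by (rule exI[of _ R], intro conjI R exI[of _ \<Phi>] mono allI holder analytic ballI left right lap) auto
qed

end
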